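(* Let $d\ge1$, $k\ge2$, $h\ge2$, $r\ge kh$ be integers. For all sufficiently large $n$ and every subset $A\subseteq[n]^d$ with $|A|\ge\frac{n^d}{\log n}$, there exists a collection $\mathcal{C}$ of $r$-templates of $A$ such that (i) every $r$-template of $A$ without rainbow solutions to the $B_{k,h}$-equation is a subtemplate of some $P\in\mathcal{C}$; (ii) for every $P\in\mathcal{C}$, $R(P)\le\frac{1}{(\log n)^{5kh}}|A|^{k(h-1)+1}$; (iii) $|\mathcal{C}|\le 2^{|A|\,n^{-\frac{k(h-1)}{kh-1}d}(\log n)^{10}}$.
   Context: $[n]^d$ is the set of vectors in $\mathbb{Z}^d$ with coordinates in $\{1,\dots,n\}$, with coordinatewise addition. The $B_{k,h}$-equation is $\sum_{i=1}^h x_{1,i}=\cdots=\sum_{i=1}^h x_{k,i}$ in points $x_{\ell,i}$, $\ell\in[k],i\in[h]$. An $r$-template of $A$ is a function $P:A\to 2^{[r]}$ (each $P(x)\subseteq[r]$ is the palette at $x$). $P_1$ is a subtemplate of $P_2$ if $P_1(x)\subseteq P_2(x)$ for all $x\in A$. An $r$-template $P$ is a rainbow solution to the $B_{k,h}$-equation if there are $kh$ points $x_{\ell,i}\in A$ satisfying the $B_{k,h}$-equation with $|P(x_{\ell,i})|=1$ for all $\ell,i$, $P(x)=\emptyset$ for all other $x\in A$, and the palettes $P(x_{\ell,i})$ pairwise distinct. A template contains no rainbow solutions if it has no subtemplate that is a rainbow solution. $R(P)$ is the number of subtemplates of $P$ that are rainbow solutions. Logarithms are base 2. *)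

theory Defs
  imports "HOL-Analysis.Analysis"
begin

text \<open>The grid $[n]^d$ with $d$ = \<^term>\<open>CARD('d)\<close>.\<close>

definition grid :: "nat \<Rightarrow> (int ^ 'd::finite) set" where
  "grid n = {x. \<forall>j. x $ j \<in> {1..int n}}"

definition B_equation :: "nat \<Rightarrow> nat \<Rightarrow> (nat \<Rightarrow> nat \<Rightarrow> 'a::comm_monoid_add) \<Rightarrow> bool" where
  "B_equation k h x \<longleftrightarrow>
     (\<forall>l\<in>{1..k}. \<forall>m\<in>{1..k}. (\<Sum>i=1..h. x l i) = (\<Sum>i=1..h. x m i))"

text \<open>Templates are extensional functions, so that collections of templates of \<open>A\<close> and the
  subtemplates counted by \<open>rainbow_count\<close> have the intended cardinality.\<close>

definition templates :: "nat \<Rightarrow> 'a set \<Rightarrow> ('a \<Rightarrow> nat set) set" where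
  "templates r A = A \<rightarrow>\<^sub>E Pow {1..r}"

definition subtemplate :: "'a set \<Rightarrow> ('a \<Rightarrow> nat set) \<Rightarrow> ('a \<Rightarrow> nat set) \<Rightarrow> bool" where
  "subtemplate A P1 P2 \<longleftrightarrow> (\<forall>x\<in>A. P1 x \<subseteq> P2 x)"

definition rainbow_solution ::
  "nat \<Rightarrow> nat \<Rightarrow> nat \<Rightarrow> 'a::comm_monoid_add set \<Rightarrow> ('a \<Rightarrow> nat set) \<Rightarrow> bool" where
  "rainbow_solution k h r A P \<longleftrightarrow>
     P \<in> templates r A \<and>
     (\<exists>x. (\<forall>l\<in>{1..k}. \<forall>i\<in>{1..h}. x l i \<in> A) \<and>
          B_equation k h x \<and>
          (\<forall>l\<in>{1..k}. \<forall>i\<in>{1..h}. card (P (x l i)) = 1) \<and>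
          (\<forall>y\<in>A. (\<forall>l\<in>{1..k}. \<forall>i\<in>{1..h}. y \<noteq> x l i) \<longrightarrow> P y = {}) \<and>
          inj_on (\<lambda>(l, i). P (x l i)) ({1..k} \<times> {1..h}))"

definition rainbow_subtemplates ::
  "nat \<Rightarrow> nat \<Rightarrow> nat \<Rightarrow> 'a::comm_monoid_add set \<Rightarrow> ('a \<Rightarrow> nat set) \<Rightarrow> ('a \<Rightarrow> nat set) set" where
  "rainbow_subtemplates k h r A P = {Q. rainbow_solution k h r A Q \<and> subtemplate A Q P}"

definition rainbow_free ::
  "nat \<Rightarrow> nat \<Rightarrow> nat \<Rightarrow> 'a::comm_monoid_add set \<Rightarrow> ('a \<Rightarrow> nat set) \<Rightarrow> bool" where
  "rainbow_free k h r A P \<longleftrightarrow> rainbow_subtemplates k h r A P = {}"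

definition rainbow_count ::
  "nat \<Rightarrow> nat \<Rightarrow> nat \<Rightarrow> 'a::comm_monoid_add set \<Rightarrow> ('a \<Rightarrow> nat set) \<Rightarrow> nat" where
  "rainbow_count k h r A P = card (rainbow_subtemplates k h r A P)"

end

theory Submission
  imports Defs "HOL-Real_Asymp.Real_Asymp"
begin

text \<open>
  Identify a template \<open>P\<close> of \<open>A\<close> with the vertex set \<open>Sigma A P \<subseteq> A \<times> [r]\<close>; rainbow solutions become
  the edges of a \<open>kh\<close>-uniform hypergraph, rainbow-free templates its independent sets. The
  container family comes from iterating a step that destroys a constant fraction of the edges.

  In that step, let \<open>I\<close> be independent. As long as \<open>I\<close> has a vertex \<open>v\<close> whose degree is large
  relative to the degree measure \<open>\<mu>\<close>, move the link of \<open>v\<close> into a hypergraph of uniformity one less,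
  where \<open>I\<close> is still independent, ignoring edges that contain an already saturated set. Either this
  hypergraph becomes dense and inherits the codegree bounds, and one recurses, or the vertices that
  still have large degree miss \<open>I\<close> and have \<open>\<mu>\<close>-measure bounded below, so deleting them kills many
  edges. Only the sequence of chosen vertices matters, so there are few containers.

  The step needs sets of \<open>j\<close> vertices to have codegree at most \<open>\<rho> ^ (j - 1)\<close> times the average degree.
  It is used with \<open>\<rho> = L ^ 8 / y ^ (k (h - 1))\<close>, where \<open>L = log n\<close> and \<open>y ^ (k h - 1) = n ^ d\<close>: for
  \<open>j < k h\<close> there is a power of \<open>n\<close> to spare, while for \<open>j = k h\<close> the powers of \<open>n\<close> cancel and the
  exponent \<open>8\<close> of \<open>L\<close> decides.
\<close>

section \<open>Containers for weighted hypergraphs\<close>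

text \<open>\<open>wdeg V w {}\<close> is the total weight, so edge count, degrees and codegrees are
  one function. Weights rather than edge sets are used because several links may contribute to the
  same set.\<close>

definition wdeg :: "'a set \<Rightarrow> ('a set \<Rightarrow> real) \<Rightarrow> 'a set \<Rightarrow> real" where
  "wdeg V w T = (\<Sum>e | e \<subseteq> V \<and> T \<subseteq> e. w e)"

definition weighted_uniform :: "'a set \<Rightarrow> nat \<Rightarrow> ('a set \<Rightarrow> real) \<Rightarrow> bool" where
  "weighted_uniform V i w \<longleftrightarrow> (\<forall>e. w e \<ge> 0) \<and> (\<forall>e. w e \<noteq> 0 \<longrightarrow> e \<subseteq> V \<and> card e = i)"

definition windep :: "('a set \<Rightarrow> real) \<Rightarrow> 'a set \<Rightarrow> bool" where
  "windep w I \<longleftrightarrow> (\<forall>e. e \<subseteq> I \<longrightarrow> w e = 0)"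

lemma wdeg_nonneg: "weighted_uniform V i w \<Longrightarrow> wdeg V w T \<ge> 0"
  unfolding wdeg_def weighted_uniform_def by (auto intro: sum_nonneg)

lemma wdeg_mono: "finite V \<Longrightarrow> (\<And>e. w' e \<le> w e) \<Longrightarrow> wdeg V w' T \<le> wdeg V w T"
  unfolding wdeg_def by (auto intro: sum_mono)

text \<open>Double counting of the pairs \<open>T \<subseteq> e\<close>.\<close>

lemma sum_wdeg:
  assumes "finite V" and "S \<subseteq> Pow V"
  shows "(\<Sum>T\<in>S. wdeg V w T) = (\<Sum>e\<in>Pow V. w e * card {T\<in>S. T \<subseteq> e})"
proof -
  have fS: "finite S" using assms finite_subset by blast
  have "(\<Sum>T\<in>S. wdeg V w T) = (\<Sum>T\<in>S. \<Sum>e\<in>Pow V. if T \<subseteq> e then w e else 0)"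
    unfolding wdeg_def using assms(1)
    by (intro sum.cong[OF refl] sum.mono_neutral_cong_left) auto
  also have "\<dots> = (\<Sum>e\<in>Pow V. \<Sum>T\<in>S. if T \<subseteq> e then w e else 0)"
    by (rule sum.swap)
  also have "\<dots> = (\<Sum>e\<in>Pow V. w e * card {T\<in>S. T \<subseteq> e})"
    using fS by (simp add: sum.If_cases Int_def mult.commute)
  finally show ?thesis .
qed

lemma sum_wdeg_singletons:
  assumes "finite V" and "weighted_uniform V i w"
  shows "(\<Sum>v\<in>V. wdeg V w {v}) = i * wdeg V w {}"
proof -
  have "(\<Sum>v\<in>V. wdeg V w {v}) = (\<Sum>T\<in>(\<lambda>v. {v}) ` V. wdeg V w T)"
    by (subst sum.reindex) auto
  also have "\<dots> = (\<Sum>e\<in>Pow V. w e * card {T\<in>(\<lambda>v. {v}) ` V. T \<subseteq> e})"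
    using assms by (intro sum_wdeg) auto
  also have "\<dots> = (\<Sum>e\<in>Pow V. w e * i)"
  proof (intro sum.cong refl)
    fix e assume e: "e \<in> Pow V"
    have "{T\<in>(\<lambda>v. {v}) ` V. T \<subseteq> e} = (\<lambda>v. {v}) ` e" using e by auto
    hence "card {T\<in>(\<lambda>v. {v}) ` V. T \<subseteq> e} = card e" by (simp add: card_image)
    thus "w e * card {T\<in>(\<lambda>v. {v}) ` V. T \<subseteq> e} = w e * i"
      using assms(2) by (cases "w e = 0") (auto simp: weighted_uniform_def)
  qed
  also have "\<dots> = i * wdeg V w {}"
    by (simp add: wdeg_def sum_distrib_left mult.commute Pow_def)
  finally show ?thesis .
qed

text \<open>\<open>insert v\<close> maps the sets avoiding \<open>v\<close> bijectively onto those
  containing \<open>v\<close>. If \<open>v \<in> T\<close>, no \<open>f\<close> with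
  \<open>T \<subseteq> f\<close> avoids \<open>v\<close>.\<close>

lemma sum_link:
  assumes "finite V" and "v \<in> V"
  shows "(\<Sum>f | f \<subseteq> V \<and> T \<subseteq> f. if v \<notin> f then w (insert v f) else 0)
    = (if v \<in> T then 0 else wdeg V w (insert v T))"
proof (cases "v \<in> T")
  case True
  then show ?thesis by simp (intro sum.neutral, auto)
next
  case False
  have "(\<Sum>f | f \<subseteq> V \<and> T \<subseteq> f. if v \<notin> f then w (insert v f) else 0)
     = (\<Sum>f | f \<subseteq> V \<and> T \<subseteq> f \<and> v \<notin> f. w (insert v f))"
    using assms(1) by (intro sum.mono_neutral_cong_right) auto
  also have "\<dots> = sum w (insert v ` {f. f \<subseteq> V \<and> T \<subseteq> f \<and> v \<notin> f})"
    by (subst sum.reindex) (auto simp: inj_on_def)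
  also have "insert v ` {f. f \<subseteq> V \<and> T \<subseteq> f \<and> v \<notin> f} = {e. e \<subseteq> V \<and> insert v T \<subseteq> e}"
  proof (intro equalityI subsetI)
    fix e assume "e \<in> {e. e \<subseteq> V \<and> insert v T \<subseteq> e}"
    hence "e = insert v (e - {v})" "e - {v} \<in> {f. f \<subseteq> V \<and> T \<subseteq> f \<and> v \<notin> f}"
      using False by auto
    thus "e \<in> insert v ` {f. f \<subseteq> V \<and> T \<subseteq> f \<and> v \<notin> f}" by blast
  qed (use assms in auto)
  finally show ?thesis using False by (simp add: wdeg_def)
qed

text \<open>In the application \<open>\<mu>\<close> is the normalised degree. \<open>t\<close>
  bounds the number of vertices chosen at one uniformity: each link adds at least
  \<open>m / 4\<close> of the total weight of \<open>w\<close>, so \<open>t_ge\<close> makes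
  \<open>t\<close> of them add up to the fraction \<open>\<rho>\<close>.\<close>

locale vertex_measure =
  fixes V :: "'a set" and \<mu> :: "'a \<Rightarrow> real" and m \<rho> :: real and t :: nat
  assumes finV: "finite V" and m_pos: "m > 0" and \<rho>_pos: "\<rho> > 0"
    and m_le: "\<And>v. v \<in> V \<Longrightarrow> m \<le> \<mu> v" and sum_le: "sum \<mu> V \<le> 1"
    and t_ge: "4 * \<rho> \<le> m * real t"
begin

text \<open>Degrees are compared with \<open>\<mu>\<close> itself, larger codegrees with its lower
  bound \<open>m\<close>, shrunk by one factor \<open>\<rho>\<close> per further vertex.\<close>

definition bnd :: "'a set \<Rightarrow> real" where
  "bnd T = (if card T = 1 then sum \<mu> T else \<rho> ^ (card T - 1) * m)"

definition spread :: "nat \<Rightarrow> real \<Rightarrow> ('a set \<Rightarrow> real) \<Rightarrow> bool" where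
  "spread i K w \<longleftrightarrow> weighted_uniform V i w \<and> wdeg V w {} > 0 \<and>
     (\<forall>T. T \<subseteq> V \<longrightarrow> T \<noteq> {} \<longrightarrow> wdeg V w T \<le> K * bnd T * wdeg V w {})"

text \<open>The sets \<open>V - X\<close> are the containers. Several weights are allowed because,
  while links are being collected, independence is known in \<open>w\<close> and in the collected
  weight at once.\<close>

definition hits :: "('a set \<Rightarrow> real) set \<Rightarrow> real \<Rightarrow> 'a set set \<Rightarrow> bool" where
  "hits ws \<delta> \<X> \<longleftrightarrow> (\<forall>X\<in>\<X>. X \<subseteq> V \<and> sum \<mu> X \<ge> \<delta>) \<and>
     (\<forall>I. (\<forall>w\<in>ws. windep w I) \<longrightarrow> (\<exists>X\<in>\<X>. X \<inter> I = {}))"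

lemma hits_finite: "hits ws \<delta> \<X> \<Longrightarrow> finite \<X>"
  using finV unfolding hits_def by (meson PowI finite_Pow_iff finite_subset subsetI)

lemma hitsD: "hits ws \<delta> \<X> \<Longrightarrow> \<forall>w\<in>ws. windep w I \<Longrightarrow> \<exists>X\<in>\<X>. X \<inter> I = {}"
  by (simp add: hits_def)

lemma hits_mono:
  assumes "hits ws \<delta> \<X>" and "ws \<subseteq> ws'" and "\<delta>' \<le> \<delta>"
  shows "hits ws' \<delta>' \<X>"
  unfolding hits_def
proof (intro conjI ballI allI impI)
  fix X assume "X \<in> \<X>"
  thus "X \<subseteq> V" "sum \<mu> X \<ge> \<delta>'" using assms(1,3) by (force simp: hits_def)+
next
  fix I assume "\<forall>w\<in>ws'. windep w I"
  thus "\<exists>X\<in>\<X>. X \<inter> I = {}" using assms(1,2) by (simp add: hits_def subset_eq)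
qed

lemma bnd_pos: "T \<subseteq> V \<Longrightarrow> bnd T > 0"
proof -
  assume "T \<subseteq> V"
  have "sum \<mu> T > 0" if "card T = 1"
    using that \<open>T \<subseteq> V\<close> m_le m_pos by (force simp: card_1_singleton_iff)
  thus ?thesis using m_pos \<rho>_pos by (simp add: bnd_def)
qed

text \<open>This is how links inherit codegree bounds. For a singleton \<open>T\<close> it rests on
  \<open>m \<le> \<mu> x\<close>; for larger \<open>T\<close> both sides are equal.\<close>

lemma bnd_insert:
  assumes "T \<subseteq> V" "v \<in> V" "v \<notin> T" "T \<noteq> {}"
  shows "bnd (insert v T) \<le> \<rho> * bnd T"
proof -
  have fT: "finite T" using assms finV finite_subset by blast
  hence c: "card (insert v T) = Suc (card T)" "card T \<noteq> 0" using assms by auto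
  show ?thesis
  proof (cases "card T = 1")
    case True
    then obtain x where "T = {x}" by (auto simp: card_1_singleton_iff)
    thus ?thesis using c assms m_le \<rho>_pos by (simp add: bnd_def)
  next
    case False
    with c obtain q where "card T = Suc (Suc q)"
      by (metis One_nat_def not0_implies_Suc)
    thus ?thesis using c by (simp add: bnd_def)
  qed
qed

section \<open>Collecting links under a degree cap\<close>

text \<open>\<open>u\<close> collects links of vertices of the independent set; a set is saturated once its degree
  in \<open>u\<close> exceeds the cap, and only edges of \<open>w\<close> without saturated subsets stay usable.\<close>

definition saturated :: "nat \<Rightarrow> real \<Rightarrow> ('a set \<Rightarrow> real) \<Rightarrow> ('a set \<Rightarrow> real) \<Rightarrow> 'a set \<Rightarrow> bool" where
  "saturated i K w u T \<longleftrightarrow> T \<noteq> {} \<and> T \<subseteq> V \<and>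
     wdeg V u T > 2 ^ Suc i * K * bnd T * \<rho> * wdeg V w {}"

definition usable :: "nat \<Rightarrow> real \<Rightarrow> ('a set \<Rightarrow> real) \<Rightarrow> ('a set \<Rightarrow> real) \<Rightarrow> 'a set \<Rightarrow> real" where
  "usable i K w u e = (if \<exists>T\<subseteq>e. saturated i K w u T then 0 else w e)"

definition add_link :: "'a \<Rightarrow> ('a set \<Rightarrow> real) \<Rightarrow> ('a set \<Rightarrow> real) \<Rightarrow> 'a set \<Rightarrow> real" where
  "add_link v w u f = u f + (if v \<notin> f then w (insert v f) else 0)"

text \<open>The summand \<open>1\<close> next to \<open>2 ^ Suc i\<close> is the overshoot: an
  unsaturated set is still within the cap, and one more link adds at most
  \<open>K * bnd T * \<rho> * wdeg V w {}\<close> to its degree.\<close>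

definition link_state :: "nat \<Rightarrow> real \<Rightarrow> ('a set \<Rightarrow> real) \<Rightarrow> ('a set \<Rightarrow> real) \<Rightarrow> bool" where
  "link_state i K w u \<longleftrightarrow> weighted_uniform V i u \<and>
     (\<forall>T. T \<subseteq> V \<longrightarrow> T \<noteq> {} \<longrightarrow> wdeg V u T \<le> (2 ^ Suc i + 1) * K * bnd T * \<rho> * wdeg V w {})"

lemma usable_uniform: "weighted_uniform V i w \<Longrightarrow> weighted_uniform V i (usable j K w u)"
  by (auto simp: weighted_uniform_def usable_def)

lemma usable_le: "weighted_uniform V i w \<Longrightarrow> usable j K w u e \<le> w e"
  by (auto simp: weighted_uniform_def usable_def)

lemma wdeg_add_link:
  "v \<in> V \<Longrightarrow> wdeg V (add_link v w u) T = wdeg V u T + (if v \<in> T then 0 else wdeg V w (insert v T))"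
  using sum_link[OF finV, where v = v and T = T and w = w] unfolding wdeg_def add_link_def by (simp add: sum.distrib)

lemma link_state_add_link:
  assumes w: "spread (Suc i) K w" and K: "K > 0" and u: "link_state i K w u" and v: "v \<in> V"
  shows "link_state i K w (add_link v (usable i K w u) u)"
proof -
  let ?w' = "usable i K w u" and ?W = "wdeg V w {}"
  have w': "weighted_uniform V (Suc i) ?w'" using w usable_uniform by (auto simp: spread_def)
  have uu: "weighted_uniform V i u" using u by (auto simp: link_state_def)
  have W: "?W > 0" using w by (simp add: spread_def)
  have "weighted_uniform V i (add_link v ?w' u)"
    unfolding weighted_uniform_def
  proof (intro conjI allI impI)
    fix e show "add_link v ?w' u e \<ge> 0"
      using w' uu by (auto simp: add_link_def weighted_uniform_def)
    assume "add_link v ?w' u e \<noteq> 0"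
    hence "u e \<noteq> 0 \<or> (v \<notin> e \<and> ?w' (insert v e) \<noteq> 0)" by (auto simp: add_link_def split: if_splits)
    hence "e \<subseteq> V \<and> (card e = i \<or> (v \<notin> e \<and> card (insert v e) = Suc i))"
      using w' uu unfolding weighted_uniform_def by blast
    thus "e \<subseteq> V" "card e = i" using finV finite_subset by fastforce+
  qed
  moreover have "wdeg V (add_link v ?w' u) T \<le> (2 ^ Suc i + 1) * K * bnd T * \<rho> * ?W"
    if T: "T \<subseteq> V" "T \<noteq> {}" for T
  proof (cases "v \<in> T \<or> saturated i K w u T")
    case True
    \<comment> \<open>A usable edge has no saturated subset, so a saturated \<open>T\<close> gains
      nothing from any link.\<close>
    have "wdeg V ?w' (insert v T) = 0" if "saturated i K w u T"
      unfolding wdeg_def using that by (intro sum.neutral) (auto simp: usable_def)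
    hence "wdeg V (add_link v ?w' u) T = wdeg V u T"
      using True v by (auto simp: wdeg_add_link)
    thus ?thesis using u T by (simp add: link_state_def)
  next
    case False
    have "wdeg V (add_link v ?w' u) T = wdeg V u T + wdeg V ?w' (insert v T)"
      using False v by (simp add: wdeg_add_link)
    also have "\<dots> \<le> 2 ^ Suc i * K * bnd T * \<rho> * ?W + wdeg V w (insert v T)"
      using False T finV w by (intro add_mono wdeg_mono usable_le) (auto simp: saturated_def spread_def)
    also have "wdeg V w (insert v T) \<le> K * bnd (insert v T) * ?W"
      using w T v by (simp add: spread_def)
    also have "\<dots> \<le> K * (\<rho> * bnd T) * ?W"
      using bnd_insert[of T v] T v False K W by (intro mult_right_mono mult_left_mono) auto
    finally show ?thesis by (simp add: algebra_simps)
  qed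
  ultimately show ?thesis by (simp add: link_state_def)
qed

text \<open>Each lost edge is charged to a saturated subset. A saturated \<open>T\<close> has
  \<open>u\<close>-degree at least \<open>2 ^ Suc i * \<rho>\<close> times its
  \<open>w\<close>-degree, while all \<open>u\<close>-degrees together sum to \<open>2 ^ i\<close>
  times the total of \<open>u\<close>, as an edge of size \<open>i\<close> has \<open>2 ^ i\<close>
  subsets. As that total is below \<open>\<rho> * wdeg V w {}\<close>, at most half of the weight is
  lost; the factor \<open>2 ^ Suc i\<close> in \<open>saturated\<close> is chosen for this.\<close>

lemma usable_total:
  assumes w: "spread (Suc i) K w" and K: "K > 0" and u: "link_state i K w u"
    and small: "wdeg V u {} < \<rho> * wdeg V w {}"
  shows "wdeg V (usable i K w u) {} \<ge> wdeg V w {} / 2"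
proof -
  let ?W = "wdeg V w {}" and ?S = "{T. saturated i K w u T}"
  have uu: "weighted_uniform V i u" using u by (auto simp: link_state_def)
  have wu: "weighted_uniform V (Suc i) w" and W: "?W > 0" using w by (auto simp: spread_def)
  have S: "?S \<subseteq> Pow V" by (auto simp: saturated_def)
  hence fS: "finite ?S" using finV finite_subset by blast
  have "?W - wdeg V (usable i K w u) {} = (\<Sum>e\<in>Pow V. w e - usable i K w u e)"
    by (simp add: wdeg_def Pow_def sum_subtractf)
  also have "\<dots> \<le> (\<Sum>e\<in>Pow V. w e * card {T\<in>?S. T \<subseteq> e})"
  proof (intro sum_mono)
    fix e
    have "w e \<le> w e * card {T\<in>?S. T \<subseteq> e}" if "\<exists>T\<subseteq>e. saturated i K w u T"
    proof -
      have "card {T\<in>?S. T \<subseteq> e} > 0" using that fS by (auto simp: card_gt_0_iff)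
      hence "1 \<le> real (card {T\<in>?S. T \<subseteq> e})" by simp
      from mult_left_mono[OF this, of "w e"] show ?thesis
        using wu by (simp add: weighted_uniform_def)
    qed
    thus "w e - usable i K w u e \<le> w e * card {T\<in>?S. T \<subseteq> e}"
      using wu by (auto simp: usable_def weighted_uniform_def)
  qed
  also have "\<dots> = (\<Sum>T\<in>?S. wdeg V w T)" using sum_wdeg[OF finV S] by simp
  also have "\<dots> \<le> (\<Sum>T\<in>?S. wdeg V u T / (2 ^ Suc i * \<rho>))"
  proof (intro sum_mono)
    fix T assume T: "T \<in> ?S"
    hence "wdeg V w T \<le> K * bnd T * ?W" using w by (auto simp: saturated_def spread_def)
    also have "\<dots> \<le> wdeg V u T / (2 ^ Suc i * \<rho>)"
      using T \<rho>_pos by (auto simp: saturated_def field_simps)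
    finally show "wdeg V w T \<le> wdeg V u T / (2 ^ Suc i * \<rho>)" .
  qed
  also have "\<dots> = (\<Sum>T\<in>?S. wdeg V u T) / (2 ^ Suc i * \<rho>)" by (simp add: sum_divide_distrib)
  also have "\<dots> \<le> (\<Sum>T\<in>Pow V. wdeg V u T) / (2 ^ Suc i * \<rho>)"
    using S finV \<rho>_pos uu by (intro divide_right_mono sum_mono2) (auto intro: wdeg_nonneg)
  also have "(\<Sum>T\<in>Pow V. wdeg V u T) = 2 ^ i * wdeg V u {}"
  proof -
    have "(\<Sum>T\<in>Pow V. wdeg V u T) = (\<Sum>e\<in>Pow V. u e * card {T\<in>Pow V. T \<subseteq> e})"
      using finV by (intro sum_wdeg) auto
    also have "\<dots> = (\<Sum>e\<in>Pow V. u e * 2 ^ i)"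
    proof (intro sum.cong refl)
      fix e assume e: "e \<in> Pow V"
      have "{T\<in>Pow V. T \<subseteq> e} = Pow e" using e by auto
      moreover have "finite e" using e finV finite_subset by auto
      ultimately have "card {T\<in>Pow V. T \<subseteq> e} = 2 ^ card e" by (simp add: card_Pow)
      thus "u e * card {T\<in>Pow V. T \<subseteq> e} = u e * 2 ^ i"
        using uu by (cases "u e = 0") (auto simp: weighted_uniform_def)
    qed
    finally show ?thesis by (simp add: wdeg_def sum_distrib_left mult.commute Pow_def)
  qed
  also have "2 ^ i * wdeg V u {} / (2 ^ Suc i * \<rho>) \<le> 2 ^ i * (\<rho> * ?W) / (2 ^ Suc i * \<rho>)"
    using small \<rho>_pos by (intro divide_right_mono mult_left_mono) auto
  also have "\<dots> = ?W / 2" using \<rho>_pos by simp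
  finally show ?thesis by simp
qed

text \<open>Since \<open>sum \<mu> V \<le> 1\<close>, the vertices that are not heavy carry at most
  a quarter of the total of \<open>w\<close> in degrees, although the degrees in \<open>w'\<close>
  sum to at least half of it. The heavy ones must supply the other quarter, and each is limited to
  \<open>K * \<mu> v\<close> times the total.\<close>

lemma heavy_measure:
  assumes w: "spread i K w" and K: "K > 0" and w': "weighted_uniform V (Suc j) w'"
    and le: "\<And>e. w' e \<le> w e" and half: "wdeg V w' {} \<ge> wdeg V w {} / 2"
  shows "sum \<mu> {v\<in>V. wdeg V w' {v} > \<mu> v * wdeg V w {} / 4} \<ge> 1 / (4 * K)"
proof -
  let ?W = "wdeg V w {}" 
  let ?X = "{v\<in>V. wdeg V w' {v} > \<mu> v * ?W / 4}"
  have W: "?W > 0" using w by (simp add: spread_def)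
  \<comment> \<open>Positive uniformity enters here: the degree sum is \<open>Suc j\<close> times
    the total weight, hence at least the total weight.\<close>
  have "?W / 2 \<le> real (Suc j) * wdeg V w' {}"
    using half wdeg_nonneg[OF w', of "{}"] mult_right_mono[of 1 "real (Suc j)" "wdeg V w' {}"]
    by simp
  also have "\<dots> = (\<Sum>v\<in>V. wdeg V w' {v})" using sum_wdeg_singletons[OF finV w'] by simp
  also have "\<dots> = (\<Sum>v\<in>V - ?X. wdeg V w' {v}) + (\<Sum>v\<in>?X. wdeg V w' {v})"
    using finV by (intro sum.subset_diff) auto
  also have "(\<Sum>v\<in>V - ?X. wdeg V w' {v}) \<le> (\<Sum>v\<in>V - ?X. \<mu> v * (?W / 4))"
    by (intro sum_mono) auto
  also have "\<dots> \<le> (\<Sum>v\<in>V. \<mu> v * (?W / 4))"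
    using finV W m_le m_pos by (intro sum_mono2) (auto intro!: mult_nonneg_nonneg, force)
  also have "\<dots> = sum \<mu> V * (?W / 4)" by (simp add: sum_distrib_right)
  also have "\<dots> \<le> 1 * (?W / 4)" using sum_le W by (intro mult_right_mono) auto
  also have "(\<Sum>v\<in>?X. wdeg V w' {v}) \<le> (\<Sum>v\<in>?X. K * \<mu> v * ?W)"
  proof (intro sum_mono)
    fix v assume "v \<in> ?X"
    have "wdeg V w' {v} \<le> wdeg V w {v}" using finV le by (rule wdeg_mono)
    also have "\<dots> \<le> K * bnd {v} * ?W" using w \<open>v \<in> ?X\<close> by (simp add: spread_def)
    finally show "wdeg V w' {v} \<le> K * \<mu> v * ?W" by (simp add: bnd_def)
  qed
  also have "\<dots> = K * sum \<mu> ?X * ?W" by (simp add: sum_distrib_left sum_distrib_right)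
  finally have "?W * (1 / 4) \<le> ?W * (K * sum \<mu> ?X)" by (simp add: algebra_simps)
  hence "1 / 4 \<le> K * sum \<mu> ?X" using W by (simp add: mult_le_cancel_left)
  thus ?thesis using K by (simp add: field_simps)
qed

section \<open>Branching over chosen vertices and recursion on the uniformity\<close>

text \<open>Induction on the number \<open>n\<close> of choices left; \<open>tot\<close> says that
  \<open>n\<close> more links bring \<open>u\<close> up to the fraction \<open>\<rho>\<close> of
  \<open>w\<close>. Either \<open>I\<close> misses the set \<open>X\<close> of heavy vertices, and
  \<open>X\<close> itself serves, or some \<open>v\<close> in both is chosen and its usable link is
  added to \<open>u\<close>. Once \<open>u\<close> is dense it is spread, and \<open>IH\<close>
  applies at the lower uniformity.\<close>

lemma hits_step:
  assumes w: "spread (Suc i) K w" and K: "K > 0" and \<delta>: "\<delta> \<le> 1 / (4 * K)" and c: "c \<ge> 1"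
    and IH: "\<And>u. spread i (2 ^ (i + 2) * K) u \<Longrightarrow> \<exists>\<X>. hits {u} \<delta> \<X> \<and> card \<X> \<le> c"
    and u: "link_state i K w u"
    and tot: "wdeg V u {} + n * (m * wdeg V w {} / 4) \<ge> \<rho> * wdeg V w {}"
  shows "\<exists>\<X>. hits {w, u} \<delta> \<X> \<and> card \<X> \<le> (card V + 1) ^ n * c"
proof -
  have W: "wdeg V w {} > 0" using w by (simp add: spread_def)
  have finish: "\<exists>\<X>. hits {w, u} \<delta> \<X> \<and> card \<X> \<le> c"
    if u: "link_state i K w u" and big: "wdeg V u {} \<ge> \<rho> * wdeg V w {}" for u
  proof -
    have "wdeg V u {} > 0" using big W \<rho>_pos by (meson less_le_trans mult_pos_pos)
    moreover have "wdeg V u T \<le> 2 ^ (i + 2) * K * bnd T * wdeg V u {}" if T: "T \<subseteq> V" "T \<noteq> {}" for T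
    proof -
      \<comment> \<open>This gives \<open>2 ^ Suc i + 1 \<le> 2 ^ (i + 2)\<close>, the loss in
        \<open>K\<close> for one drop in uniformity; the factor \<open>\<rho>\<close> is absorbed by
        the density of \<open>u\<close>.\<close>
      have two: "(1::real) \<le> 2 * 2 ^ i" using one_le_power[of "2::real" "Suc i"] by simp
      have "wdeg V u T \<le> ((2 ^ Suc i + 1) * K * bnd T) * (\<rho> * wdeg V w {})"
        using u T by (simp add: link_state_def mult.assoc)
      also have "\<dots> \<le> (2 ^ (i + 2) * K * bnd T) * wdeg V u {}"
        using big K bnd_pos[OF T(1)] W \<rho>_pos
        by (intro mult_mono) (auto intro!: mult_right_mono simp: less_imp_le two)
      finally show ?thesis .
    qed
    ultimately have "spread i (2 ^ (i + 2) * K) u"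
      using u by (auto simp: spread_def link_state_def)
    from IH[OF this] obtain \<X> where X: "hits {u} \<delta> \<X>" "card \<X> \<le> c" by blast
    have "hits {w, u} \<delta> \<X>" by (rule hits_mono[OF X(1)]) auto
    with X(2) show ?thesis by blast
  qed
  show ?thesis using u tot
  proof (induction n arbitrary: u)
    case 0
    thus ?case using finish[of u] by simp
  next
    case (Suc n)
    show ?case
    proof (cases "wdeg V u {} \<ge> \<rho> * wdeg V w {}")
      case True
      from finish[OF Suc.prems(1) True] obtain \<X> where X: "hits {w, u} \<delta> \<X>" "card \<X> \<le> c" by blast
      have "1 * c \<le> (card V + 1) ^ Suc n * c" by (intro mult_right_mono one_le_power) auto
      hence "card \<X> \<le> (card V + 1) ^ Suc n * c" using X(2) by linarith
      thus ?thesis using X(1) by blast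
    next
      case False
      let ?w' = "usable i K w u"
      define X where "X = {v\<in>V. wdeg V ?w' {v} > \<mu> v * wdeg V w {} / 4}"
      have XV: "X \<subseteq> V" by (auto simp: X_def)
      hence fX: "finite X" using finV finite_subset by blast
      have wu: "weighted_uniform V (Suc i) w" using w by (simp add: spread_def)
      have "sum \<mu> X \<ge> 1 / (4 * K)" unfolding X_def
        using False
        by (intro heavy_measure[OF w K usable_uniform[OF wu]] usable_le[OF wu]
            usable_total[OF w K Suc.prems(1)]) auto
      hence Xm: "sum \<mu> X \<ge> \<delta>" using \<delta> by linarith
      have "\<forall>v\<in>X. \<exists>\<Y>. hits {w, add_link v ?w' u} \<delta> \<Y> \<and> card \<Y> \<le> (card V + 1) ^ n * c"
      proof (rule ballI, rule Suc.IH)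
        fix v assume v: "v \<in> X"
        hence vV: "v \<in> V" using XV by auto
        show "link_state i K w (add_link v ?w' u)"
          by (rule link_state_add_link[OF w K Suc.prems(1) vV])
        have "m * wdeg V w {} / 4 \<le> \<mu> v * wdeg V w {} / 4" using m_le[OF vV] W by simp
        also have "\<dots> \<le> wdeg V ?w' {v}" using v by (simp add: X_def)
        finally show "\<rho> * wdeg V w {} \<le> wdeg V (add_link v ?w' u) {} + real n * (m * wdeg V w {} / 4)"
          using Suc.prems(2) by (simp add: wdeg_add_link[OF vV] algebra_simps add_divide_distrib)
      qed
      from bchoice[OF this] obtain \<Y>
        where Y: "\<And>v. v \<in> X \<Longrightarrow> hits {w, add_link v ?w' u} \<delta> (\<Y> v)"
        "\<And>v. v \<in> X \<Longrightarrow> card (\<Y> v) \<le> (card V + 1) ^ n * c" by blast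
      let ?\<X> = "insert X (\<Union>v\<in>X. \<Y> v)"
      have "hits {w, u} \<delta> ?\<X>"
        unfolding hits_def
      proof (intro conjI ballI allI impI)
        fix Z assume "Z \<in> ?\<X>"
        then consider "Z = X" | v where "v \<in> X" "Z \<in> \<Y> v" by auto
        hence "Z \<subseteq> V \<and> sum \<mu> Z \<ge> \<delta>"
        proof cases
          case 2
          thus ?thesis using Y(1)[of v] by (auto simp: hits_def)
        qed (use XV Xm in auto)
        thus "Z \<subseteq> V" "sum \<mu> Z \<ge> \<delta>" by auto
      next
        fix I assume "\<forall>w\<in>{w, u}. windep w I"
        hence I: "windep w I" "windep u I" by auto
        show "\<exists>Z\<in>?\<X>. Z \<inter> I = {}"
        proof (cases "X \<inter> I = {}")
          case False
          then obtain v where v: "v \<in> X" "v \<in> I" by auto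
          \<comment> \<open>For \<open>f \<subseteq> I\<close> also
            \<open>insert v f \<subseteq> I\<close>, because \<open>v \<in> I\<close>; so
            \<open>w\<close>, and with it the usable weight, vanishes there.\<close>
          have "windep (add_link v ?w' u) I"
            using I v by (auto simp: windep_def add_link_def usable_def)
          with I(1) have "\<exists>Z\<in>\<Y> v. Z \<inter> I = {}" by (intro hitsD[OF Y(1)[OF v(1)]]) simp
          thus ?thesis using v(1) by blast
        qed auto
      qed
      moreover have "card ?\<X> \<le> (card V + 1) ^ Suc n * c"
      proof -
        have "card (\<Union>v\<in>X. \<Y> v) \<le> (\<Sum>v\<in>X. card (\<Y> v))" by (rule card_UN_le[OF fX])
        also have "\<dots> \<le> card X * ((card V + 1) ^ n * c)" 
          using sum_bounded_above[of X "\<lambda>v. card (\<Y> v)" "(card V + 1) ^ n * c"] Y(2) by simp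
        also have "\<dots> \<le> card V * ((card V + 1) ^ n * c)"
          using card_mono[OF finV XV] by (intro mult_right_mono) auto
        \<comment> \<open>The set \<open>X\<close> itself accounts for the \<open>Suc\<close>; it is
          absorbed by the \<open>+ 1\<close> in the base \<open>card V + 1\<close>.\<close>
        finally have "card ?\<X> \<le> Suc (card V * ((card V + 1) ^ n * c))"
          by (intro card_insert_le_m1) auto
        moreover have "1 \<le> (card V + 1) ^ n * c" using c by (simp add: Suc_le_eq)
        moreover have "(card V + 1) ^ Suc n * c = card V * ((card V + 1) ^ n * c) + (card V + 1) ^ n * c"
          by (simp add: algebra_simps)
        ultimately show ?thesis by linarith
      qed
      ultimately show ?thesis by blast
    qed
  qed
qed

text \<open>Each of the \<open>i\<close> levels costs at most \<open>t\<close> choices and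
  multiplies \<open>K\<close> by \<open>2 ^ (i + 2)\<close>; the square in the exponent dominates
  the product of these losses.\<close>

theorem hits_exist:
  assumes "spread i K w" and "K > 0"
  shows "\<exists>\<X>. hits {w} (1 / (4 * K * 2 ^ ((i + 1)\<^sup>2))) \<X> \<and> card \<X> \<le> (card V + 1) ^ (i * t)"
  using assms
proof (induction i arbitrary: K w)
  case 0
  \<comment> \<open>At uniformity 0 the positive total weight sits on the empty set, so no set is
    independent and the empty family suffices.\<close>
  have "wdeg V w {} = w {}"
  proof -
    have "wdeg V w {} = (\<Sum>e\<in>{{}}. w e)" unfolding wdeg_def
      using 0 finV finite_subset[OF _ finV]
      by (intro sum.mono_neutral_right) (auto simp: spread_def weighted_uniform_def)
    thus ?thesis by simp
  qed
  hence "hits {w} (1 / (4 * K * 2 ^ ((0 + 1)\<^sup>2))) {}"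
    using 0 by (auto simp: hits_def windep_def spread_def)
  thus ?case by fastforce
next
  case (Suc i)
  let ?\<delta> = "1 / (4 * K * 2 ^ ((Suc i + 1)\<^sup>2))"
  have "\<exists>\<X>. hits {w, \<lambda>_. 0} ?\<delta> \<X> \<and> card \<X> \<le> (card V + 1) ^ t * (card V + 1) ^ (i * t)"
  proof (rule hits_step[OF Suc.prems])
    show "?\<delta> \<le> 1 / (4 * K)" using Suc.prems(2)
      by (intro divide_left_mono) auto
    show "1 \<le> (card V + 1) ^ (i * t)" by simp
    show "link_state i K w (\<lambda>_. 0)"
      using Suc.prems bnd_pos \<rho>_pos
      by (auto simp: link_state_def weighted_uniform_def wdeg_def spread_def less_imp_le intro!: mult_nonneg_nonneg)
    show "\<rho> * wdeg V w {} \<le> wdeg V (\<lambda>_. 0) {} + real t * (m * wdeg V w {} / 4)"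
    proof -
      have "4 * \<rho> * wdeg V w {} \<le> m * real t * wdeg V w {}"
        using t_ge Suc.prems(1) by (intro mult_right_mono) (auto simp: spread_def)
      thus ?thesis by (simp add: wdeg_def algebra_simps)
    qed
  next
    fix u assume u: "spread i (2 ^ (i + 2) * K) u"
    obtain \<X> where X: "hits {u} (1 / (4 * (2 ^ (i + 2) * K) * 2 ^ ((i + 1)\<^sup>2))) \<X>"
      "card \<X> \<le> (card V + 1) ^ (i * t)"
      using Suc.IH[OF u] Suc.prems(2) by auto
    \<comment> \<open>The squares differ by \<open>2 * i + 3\<close>, which is at least
      \<open>i + 2\<close>.\<close>
    have "(2::real) ^ (i + 2) * 2 ^ ((i + 1)\<^sup>2) \<le> 2 ^ ((Suc i + 1)\<^sup>2)"
      unfolding power_add[symmetric] by (intro power_increasing) (auto simp: power2_eq_square)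
    hence "4 * (2 ^ (i + 2) * K) * 2 ^ ((i + 1)\<^sup>2) \<le> 4 * K * 2 ^ ((Suc i + 1)\<^sup>2)"
      using Suc.prems(2) mult_left_mono[of _ _ "4 * K"] by (simp add: mult_ac)
    hence "?\<delta> \<le> 1 / (4 * (2 ^ (i + 2) * K) * 2 ^ ((i + 1)\<^sup>2))"
      using Suc.prems(2) by (intro divide_left_mono) auto
    thus "\<exists>\<X>. hits {u} ?\<delta> \<X> \<and> card \<X> \<le> (card V + 1) ^ (i * t)"
      using X hits_mono[OF X(1) subset_refl] by blast
  qed
  then obtain \<X> where "hits {w, \<lambda>_. 0} ?\<delta> \<X>" "card \<X> \<le> (card V + 1) ^ (Suc i * t)"
    by (auto simp: power_add)
  moreover have "hits {w} ?\<delta> \<X>" if "hits {w, \<lambda>_. 0} ?\<delta> \<X>" for \<X>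
    using that by (simp add: hits_def windep_def)
  ultimately show ?case by blast
qed

end

section \<open>Containers for edge sets\<close>

lemma sum_incidences:
  assumes "finite X" and "finite E"
  shows "(\<Sum>v\<in>X. card {e\<in>E. v \<in> e}) = (\<Sum>e\<in>E. card (e \<inter> X))"
proof -
  have "(\<Sum>v\<in>X. card {e\<in>E. v \<in> e}) = (\<Sum>v\<in>X. \<Sum>e\<in>E. if v \<in> e then 1 else 0)"
    using assms by (simp add: sum.If_cases Int_def)
  also have "\<dots> = (\<Sum>e\<in>E. \<Sum>v\<in>X. if v \<in> e then 1 else 0)" by (rule sum.swap)
  also have "\<dots> = (\<Sum>e\<in>E. card (e \<inter> X))"
    using assms by (simp add: sum.If_cases Int_def conj_commute)
  finally show ?thesis .
qed

text \<open>A set \<open>X\<close> of measure at least \<open>\<delta>\<close> has degree sum at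
  least \<open>\<delta> * s * card E\<close>, and an edge is counted at most \<open>s\<close> times
  in it, so at least \<open>\<delta> * card E\<close> edges meet \<open>X\<close>. The sets
  \<open>X\<close> are found in a subhypergraph, but \<open>\<mu>\<close> uses degrees in
  \<open>E\<close>, so the loss is a fraction of all of \<open>E\<close>.\<close>

lemma container_step:
  fixes V :: "'a set" and E :: "'a set set" and \<rho> :: real and s t :: nat
  assumes V: "finite V" and E: "E \<subseteq> Pow V" "E \<noteq> {}" and s: "\<And>e. e \<in> E \<Longrightarrow> card e = s" "s \<ge> 1"
    and \<rho>: "\<rho> > 0" and t: "8 * s * \<rho> * card V \<le> t"
    and codeg: "\<And>T. T \<subseteq> V \<Longrightarrow> card T \<ge> 2 \<Longrightarrow>
      card {e\<in>E. T \<subseteq> e} \<le> \<rho> ^ (card T - 1) * card E / card V"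
  shows "\<exists>\<X>. finite \<X> \<and> card \<X> \<le> (card V + 1) ^ (s * t) \<and>
    (\<forall>X\<in>\<X>. card {e\<in>E. e \<inter> X = {}} \<le> (1 - 1 / (16 * s * 2 ^ ((s + 1)\<^sup>2))) * card E) \<and>
    (\<forall>I. (\<forall>e\<in>E. \<not> e \<subseteq> I) \<longrightarrow> (\<exists>X\<in>\<X>. X \<inter> I = {}))"
proof -
  define M where "M = real (card E)"
  define N where "N = real (card V)"
  define deg where "deg = (\<lambda>v. real (card {e\<in>E. v \<in> e}))"
  have fE: "finite E" using V E finite_subset by blast
  have M: "M > 0" using fE E by (simp add: M_def card_gt_0_iff)
  obtain e0 where "e0 \<in> E" using E by blast
  hence "e0 \<noteq> {}" "e0 \<subseteq> V" using s E by force+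
  hence N: "N > 0" using V by (auto simp: N_def card_gt_0_iff)
  have sum_deg: "(\<Sum>v\<in>X. deg v) = (\<Sum>e\<in>E. real (card (e \<inter> X)))" if "X \<subseteq> V" for X
    using sum_incidences[of X E] fE that V finite_subset[OF that V]
    by (simp add: deg_def flip: of_nat_sum)
  have "(\<Sum>v\<in>V. deg v) = (\<Sum>e\<in>E. real (card (e \<inter> V)))" by (rule sum_deg) simp
  also have "\<dots> = (\<Sum>e\<in>E. real s)"
    using E s by (intro sum.cong refl) (metis Int_absorb2 PowD subsetD)
  finally have sum_deg_V: "(\<Sum>v\<in>V. deg v) = M * s" by (simp add: M_def)
  text \<open>Discarding the edges through vertices of low degree loses at most half of the edges and
    makes the degree measure bounded below.\<close>
  define V' where "V' = {v\<in>V. deg v \<ge> M / (2 * N)}"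
  define E' where "E' = {e\<in>E. e \<subseteq> V'}"
  have V'V: "V' \<subseteq> V" by (auto simp: V'_def)
  have fV': "finite V'" using V V'V finite_subset by blast
  have E'E: "E' \<subseteq> E" by (auto simp: E'_def)
  have fE': "finite E'" using fE E'E finite_subset by blast
  have "real (card (E - E')) \<le> real (card (\<Union>v\<in>V - V'. {e\<in>E. v \<in> e}))"
    using fE V E by (intro of_nat_mono card_mono) (auto simp: E'_def)
  also have "\<dots> \<le> (\<Sum>v\<in>V - V'. deg v)"
    using card_UN_le[of "V - V'" "\<lambda>v. {e\<in>E. v \<in> e}"] V
    by (simp add: deg_def flip: of_nat_sum)
  also have "\<dots> \<le> (\<Sum>v\<in>V - V'. M / (2 * N))"
    by (intro sum_mono) (auto simp: V'_def)
  also have "\<dots> \<le> (\<Sum>v\<in>V. M / (2 * N))"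
    using V M N by (intro sum_mono2) auto
  also have "\<dots> = M / 2" using N by (simp add: N_def)
  finally have E'_half: "real (card E') \<ge> M / 2"
    using card_Diff_subset[OF fE' E'E] card_mono[OF fE E'E] by (simp add: M_def)
  \<comment> \<open>The degrees sum to \<open>s * M\<close>, so \<open>\<mu>\<close> has total mass
    1 on \<open>V\<close>; degree at least \<open>M / (2 * N)\<close> becomes measure at least
    \<open>m\<close>.\<close>
  define \<mu> where "\<mu> = (\<lambda>v. deg v / (s * M))"
  define w where "w = (\<lambda>e. if e \<in> E' then 1 else 0 :: real)"
  define m where "m = 1 / (2 * s * N)"
  interpret vertex_measure V' \<mu> m \<rho> t
  proof
    show "m \<le> \<mu> v" if "v \<in> V'" for v
      using that M N s by (simp add: V'_def \<mu>_def m_def field_simps)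
    have "sum \<mu> V' \<le> sum \<mu> V"
      using V V'V M by (intro sum_mono2) (auto simp: \<mu>_def deg_def)
    also have "\<dots> = 1" using sum_deg_V M s by (simp add: \<mu>_def flip: sum_divide_distrib)
    finally show "sum \<mu> V' \<le> 1" .
    show "4 * \<rho> \<le> m * t" using t N s by (simp add: m_def N_def field_simps)
  qed (use fV' N s \<rho> in \<open>auto simp: m_def\<close>)
  have wdeg_eq: "wdeg V' w T = card {e\<in>E'. T \<subseteq> e}" for T
  proof -
    have "wdeg V' w T = (\<Sum>e\<in>{e\<in>E'. T \<subseteq> e}. 1)"
      unfolding wdeg_def w_def using fV'
      by (intro sum.mono_neutral_cong_right) (auto simp: E'_def)
    thus ?thesis by simp
  qed
  have W: "wdeg V' w {} = card E'" by (simp add: wdeg_eq)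
  \<comment> \<open>The constant \<open>4 * s\<close> comes from sets of two or more vertices:
    \<open>M \<le> 2 * card E'\<close> and \<open>1 / N = 2 * s * m\<close>. Singletons fit within
    it as well.\<close>
  have "spread s (4 * s) w"
    unfolding spread_def
  proof (intro conjI allI impI)
    show "weighted_uniform V' s w" using s by (auto simp: weighted_uniform_def w_def E'_def)
    show "wdeg V' w {} > 0" using W E'_half M by simp
  next
    fix T assume T: "T \<subseteq> V'" "T \<noteq> {}"
    have fT: "finite T" using T fV' finite_subset by blast
    have le: "wdeg V' w T \<le> card {e\<in>E. T \<subseteq> e}"
      unfolding wdeg_eq using fE E'E by (intro of_nat_mono card_mono) auto
    show "wdeg V' w T \<le> real (4 * s) * bnd T * wdeg V' w {}"
    proof (cases "card T = 1")
      case True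
      then obtain v where v: "T = {v}" by (auto simp: card_1_singleton_iff)
      have "wdeg V' w T \<le> deg v" using le v by (simp add: deg_def)
      also have "\<dots> = s * \<mu> v * M" using M s by (simp add: \<mu>_def)
      also have "\<dots> \<le> s * \<mu> v * (4 * card E')"
        using E'_half M by (intro mult_left_mono) (auto simp: \<mu>_def deg_def)
      finally show ?thesis using v W by (simp add: bnd_def mult_ac)
    next
      case False
      hence "card T \<ge> 2" using T fT card_0_eq[of T] by (cases "card T") auto
      hence "card {e\<in>E. T \<subseteq> e} \<le> \<rho> ^ (card T - 1) * M / N"
        using codeg T V'V unfolding M_def N_def by blast
      also have "\<dots> \<le> \<rho> ^ (card T - 1) * (2 * card E') / N"
        using E'_half \<rho> N by (intro divide_right_mono mult_left_mono) auto
      also have "\<dots> = real (4 * s) * (\<rho> ^ (card T - 1) * m) * card E'"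
        using N s(2) by (simp add: m_def field_simps)
      finally show ?thesis using le False W by (simp add: bnd_def)
    qed
  qed
  from hits_exist[OF this] s obtain \<X>
    where X: "hits {w} (1 / (4 * real (4 * s) * 2 ^ ((s + 1)\<^sup>2))) \<X>"
      "card \<X> \<le> (card V' + 1) ^ (s * t)" by auto
  have "(card V' + 1) ^ (s * t) \<le> (card V + 1) ^ (s * t)"
    using card_mono[OF V V'V] by (intro power_mono) auto
  hence "card \<X> \<le> (card V + 1) ^ (s * t)" using X(2) by linarith
  moreover have "card {e\<in>E. e \<inter> Y = {}} \<le> (1 - 1 / (16 * s * 2 ^ ((s + 1)\<^sup>2))) * card E"
    if Y: "Y \<in> \<X>" for Y
  proof -
    define \<delta> :: real where "\<delta> = 1 / (16 * s * 2 ^ ((s + 1)\<^sup>2))"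
    have YV: "Y \<subseteq> V" and "sum \<mu> Y \<ge> \<delta>" using X(1) Y V'V by (auto simp: hits_def \<delta>_def)
    hence "\<delta> * (s * M) \<le> (\<Sum>v\<in>Y. deg v)"
      using M s by (simp add: \<mu>_def field_simps flip: sum_divide_distrib)
    also have "\<dots> = (\<Sum>e\<in>E. real (card (e \<inter> Y)))" by (rule sum_deg[OF YV])
    also have "\<dots> = (\<Sum>e\<in>{e\<in>E. e \<inter> Y \<noteq> {}}. real (card (e \<inter> Y)))"
      using fE by (intro sum.mono_neutral_right) auto
    also have "\<dots> \<le> (\<Sum>e\<in>{e\<in>E. e \<inter> Y \<noteq> {}}. real s)"
    proof (intro sum_mono)
      fix e assume "e \<in> {e\<in>E. e \<inter> Y \<noteq> {}}"
      hence "card e = s" using s by auto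
      moreover from this have "finite e" using s(2) card.infinite[of e] by fastforce
      ultimately
      show "real (card (e \<inter> Y)) \<le> real s" using card_mono[of e "e \<inter> Y"] by auto
    qed
    also have "\<dots> = s * real (card {e\<in>E. e \<inter> Y \<noteq> {}})" by simp
    finally have "real (card {e\<in>E. e \<inter> Y \<noteq> {}}) \<ge> \<delta> * M" using s by (simp add: mult_ac)
    moreover have "real (card {e\<in>E. e \<inter> Y \<noteq> {}}) + real (card {e\<in>E. e \<inter> Y = {}}) = M"
    proof -
      have "card E = card ({e\<in>E. e \<inter> Y \<noteq> {}} \<union> {e\<in>E. e \<inter> Y = {}})"
        by (rule arg_cong[of _ _ card]) auto
      also have "\<dots> = card {e\<in>E. e \<inter> Y \<noteq> {}} + card {e\<in>E. e \<inter> Y = {}}"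
        using fE by (intro card_Un_disjoint) auto
      finally show ?thesis by (simp add: M_def)
    qed
    ultimately show ?thesis unfolding \<delta>_def[symmetric] M_def[symmetric] by (simp add: algebra_simps)
  qed
  moreover have "\<exists>Y\<in>\<X>. Y \<inter> I = {}" if I: "\<forall>e\<in>E. \<not> e \<subseteq> I" for I
  proof -
    have "windep w I" using I by (auto simp: windep_def w_def E'_def)
    thus ?thesis using X(1) by (simp add: hits_def)
  qed
  ultimately show ?thesis using hits_finite[OF X(1)] by blast
qed

lemma step_fraction_le_1:
  assumes "s \<ge> 1"
  shows "1 / real (16 * s * 2 ^ ((s + 1)\<^sup>2)) \<le> 1"
proof -
  have "16 * s * 2 ^ ((s + 1)\<^sup>2) \<noteq> 0" using assms by simp
  hence "1 \<le> 16 * s * 2 ^ ((s + 1)\<^sup>2)" by linarith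
  hence "1 \<le> real (16 * s * 2 ^ ((s + 1)\<^sup>2))" by (metis of_nat_1 of_nat_le_iff)
  moreover have "1 / x \<le> 1" if "1 \<le> x" for x :: real using that by simp
  ultimately show ?thesis by blast
qed

section \<open>Iterating the step\<close>

definition container_family :: "'a set \<Rightarrow> 'a set set \<Rightarrow> real \<Rightarrow> 'a set set \<Rightarrow> bool" where
  "container_family V E \<theta> \<C> \<longleftrightarrow> finite \<C> \<and>
    (\<forall>C\<in>\<C>. C \<subseteq> V \<and> real (card {e\<in>E. e \<subseteq> C}) \<le> \<theta>) \<and>
    (\<forall>I\<subseteq>V. (\<forall>e\<in>E. \<not> e \<subseteq> I) \<longrightarrow> (\<exists>C\<in>\<C>. I \<subseteq> C))"

lemma container_family_whole:
  "E \<subseteq> Pow V \<Longrightarrow> real (card E) \<le> \<theta> \<Longrightarrow> container_family V E \<theta> {V}"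
proof -
  assume "E \<subseteq> Pow V" "real (card E) \<le> \<theta>"
  moreover from this have "{e\<in>E. e \<subseteq> V} = E" by auto
  ultimately show ?thesis by (auto simp: container_family_def)
qed

text \<open>The edges inside \<open>D - X\<close> are exactly the edges inside \<open>D\<close> that
  miss \<open>X\<close>, so removing \<open>X\<close> from a container of the smaller hypergraph
  gives one for \<open>E\<close>.\<close>

lemma container_family_UN:
  assumes "finite \<X>" and hit: "\<And>I. (\<forall>e\<in>E. \<not> e \<subseteq> I) \<Longrightarrow> \<exists>X\<in>\<X>. X \<inter> I = {}"
    and F: "\<And>X. X \<in> \<X> \<Longrightarrow> container_family V {e\<in>E. e \<inter> X = {}} \<theta> (F X)"
  shows "container_family V E \<theta> (\<Union>X\<in>\<X>. (\<lambda>C. C - X) ` F X)"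
  unfolding container_family_def
proof (intro conjI ballI allI impI)
  show "finite (\<Union>X\<in>\<X>. (\<lambda>C. C - X) ` F X)"
    using assms(1) F by (auto simp: container_family_def)
next
  fix C assume "C \<in> (\<Union>X\<in>\<X>. (\<lambda>C. C - X) ` F X)"
  then obtain X D where XD: "X \<in> \<X>" "D \<in> F X" "C = D - X" by auto
  hence D: "D \<subseteq> V" "real (card {e\<in>{e\<in>E. e \<inter> X = {}}. e \<subseteq> D}) \<le> \<theta>"
    using F[of X] by (auto simp: container_family_def)
  have "{e\<in>E. e \<subseteq> C} = {e\<in>{e\<in>E. e \<inter> X = {}}. e \<subseteq> D}" using XD by auto
  thus "C \<subseteq> V" "real (card {e\<in>E. e \<subseteq> C}) \<le> \<theta>" using D XD by auto
next
  fix I assume I: "I \<subseteq> V" "\<forall>e\<in>E. \<not> e \<subseteq> I"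
  obtain X where X: "X \<in> \<X>" "X \<inter> I = {}" using hit[OF I(2)] by blast
  have "\<forall>e\<in>{e\<in>E. e \<inter> X = {}}. \<not> e \<subseteq> I" using I(2) by auto
  then obtain D where "D \<in> F X" "I \<subseteq> D"
    using F[OF X(1)] I(1) unfolding container_family_def by meson
  moreover have "I \<subseteq> D - X" using \<open>I \<subseteq> D\<close> X by auto
  ultimately show "\<exists>C\<in>\<Union>X\<in>\<X>. (\<lambda>C. C - X) ` F X. I \<subseteq> C" using X by auto
qed

text \<open>Each step keeps at most a fixed fraction of the edges. The codegree hypothesis is stated
  relative to \<open>\<theta>\<close>, not \<open>card E\<close>: in this form subhypergraphs
  inherit it, and it implies the hypothesis of the step as long as more than \<open>\<theta>\<close>
  edges remain.\<close>

theorem containers: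
  fixes V :: "'a set" and E :: "'a set set" and \<rho> \<theta> :: real and s t n :: nat
  assumes V: "finite V" and s: "s \<ge> 1" and \<rho>: "\<rho> > 0" and t: "8 * s * \<rho> * card V \<le> t"
    and \<theta>: "\<theta> > 0"
    and E: "E \<subseteq> Pow V" "\<And>e. e \<in> E \<Longrightarrow> card e = s"
    and codeg: "\<And>T. T \<subseteq> V \<Longrightarrow> card T \<ge> 2 \<Longrightarrow>
      card {e\<in>E. T \<subseteq> e} \<le> \<rho> ^ (card T - 1) * \<theta> / card V"
    and n: "(1 - 1 / (16 * s * 2 ^ ((s + 1)\<^sup>2))) ^ n * card E \<le> \<theta>"
  shows "\<exists>\<C>. container_family V E \<theta> \<C> \<and> card \<C> \<le> (card V + 1) ^ (s * t * n)"
  using E codeg n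
proof (induction n arbitrary: E)
  case 0
  hence "container_family V E \<theta> {V}" by (intro container_family_whole) simp_all
  thus ?case by (intro exI[of _ "{V}"]) simp
next
  case (Suc n)
  define \<delta> :: real where "\<delta> = 1 / (16 * s * 2 ^ ((s + 1)\<^sup>2))"
  have \<delta>: "\<delta> \<le> 1" unfolding \<delta>_def by (rule step_fraction_le_1[OF s])
  have fE: "finite E" using V Suc.prems(1) finite_subset by blast
  show ?case
  proof (cases "card E \<le> \<theta>")
    case True
    hence "container_family V E \<theta> {V}" using Suc.prems(1) by (intro container_family_whole)
    thus ?thesis by (intro exI[of _ "{V}"]) simp
  next
    case False
    have cod: "card {e\<in>E. T \<subseteq> e} \<le> \<rho> ^ (card T - 1) * card E / card V"
      if T: "T \<subseteq> V" "card T \<ge> 2" for T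
    proof -
      have "\<rho> ^ (card T - 1) * \<theta> / card V \<le> \<rho> ^ (card T - 1) * card E / card V"
        using False \<rho> by (intro divide_right_mono mult_left_mono) auto
      thus ?thesis using Suc.prems(3)[OF T] by linarith
    qed
    have "E \<noteq> {}" using False \<theta> by auto
    from container_step[OF V Suc.prems(1) this Suc.prems(2) s \<rho> t cod]
    obtain \<X> where XX: "finite \<X> \<and> card \<X> \<le> (card V + 1) ^ (s * t) \<and>
      (\<forall>X\<in>\<X>. card {e\<in>E. e \<inter> X = {}} \<le> (1 - \<delta>) * card E) \<and>
      (\<forall>I. (\<forall>e\<in>E. \<not> e \<subseteq> I) \<longrightarrow> (\<exists>X\<in>\<X>. X \<inter> I = {}))"
      unfolding \<delta>_def by (rule exE)
    note X = XX[THEN conjunct1] XX[THEN conjunct2, THEN conjunct1]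
      XX[THEN conjunct2, THEN conjunct2, THEN conjunct1, THEN bspec]
      XX[THEN conjunct2, THEN conjunct2, THEN conjunct2, THEN spec, THEN mp]
    have "\<forall>X\<in>\<X>. \<exists>\<C>. container_family V {e\<in>E. e \<inter> X = {}} \<theta> \<C> \<and> card \<C> \<le> (card V + 1) ^ (s * t * n)"
    proof (rule ballI, rule Suc.IH)
      fix X assume XX: "X \<in> \<X>"
      show "{e\<in>E. e \<inter> X = {}} \<subseteq> Pow V" using Suc.prems(1) by auto
      show "card e = s" if "e \<in> {e\<in>E. e \<inter> X = {}}" for e using that Suc.prems(2) by auto
      show "card {e\<in>{e\<in>E. e \<inter> X = {}}. T \<subseteq> e} \<le> \<rho> ^ (card T - 1) * \<theta> / card V"
        if T: "T \<subseteq> V" "card T \<ge> 2" for T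
      proof -
        have "card {e\<in>{e\<in>E. e \<inter> X = {}}. T \<subseteq> e} \<le> card {e\<in>E. T \<subseteq> e}"
          using fE by (intro card_mono) auto
        hence "real (card {e\<in>{e\<in>E. e \<inter> X = {}}. T \<subseteq> e}) \<le> card {e\<in>E. T \<subseteq> e}"
          by (rule of_nat_mono)
        thus ?thesis using Suc.prems(3)[OF T] by linarith
      qed
      have "(1 - \<delta>) ^ n * card {e\<in>E. e \<inter> X = {}} \<le> (1 - \<delta>) ^ n * ((1 - \<delta>) * card E)"
        using X(3)[OF XX] \<delta> by (intro mult_left_mono) auto
      also have "\<dots> \<le> \<theta>" using Suc.prems(4) by (simp add: \<delta>_def mult_ac)
      finally show "(1 - 1 / (16 * s * 2 ^ ((s + 1)\<^sup>2))) ^ n * card {e\<in>E. e \<inter> X = {}} \<le> \<theta>"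
        by (simp add: \<delta>_def)
    qed
    from bchoice[OF this] obtain F where
      F: "\<And>X. X \<in> \<X> \<Longrightarrow> container_family V {e\<in>E. e \<inter> X = {}} \<theta> (F X)"
         "\<And>X. X \<in> \<X> \<Longrightarrow> card (F X) \<le> (card V + 1) ^ (s * t * n)" by blast
    let ?\<C> = "\<Union>X\<in>\<X>. (\<lambda>C. C - X) ` F X"
    have "card ?\<C> \<le> (\<Sum>X\<in>\<X>. card ((\<lambda>C. C - X) ` F X))"
      by (rule card_UN_le[OF X(1)])
    also have "\<dots> \<le> (\<Sum>X\<in>\<X>. (card V + 1) ^ (s * t * n))"
    proof (rule sum_mono)
      fix X assume X: "X \<in> \<X>"
      hence "finite (F X)" using F(1) by (simp add: container_family_def)
      thus "card ((\<lambda>C. C - X) ` F X) \<le> (card V + 1) ^ (s * t * n)"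
        using card_image_le[of "F X" "\<lambda>C. C - X"] F(2)[OF X] by linarith
    qed
    also have "\<dots> \<le> (card V + 1) ^ (s * t) * (card V + 1) ^ (s * t * n)"
      using X(2) by simp
    finally have "card ?\<C> \<le> (card V + 1) ^ (s * t * Suc n)" by (simp add: power_add)
    thus ?thesis using container_family_UN[OF X(1,4) F(1)] by blast
  qed
qed

section \<open>The hypergraph of rainbow solutions\<close>

definition solutions :: "nat \<Rightarrow> nat \<Rightarrow> 'a::comm_monoid_add set \<Rightarrow> (nat \<times> nat \<Rightarrow> 'a) set" where
  "solutions k h A = {x \<in> ({1..k} \<times> {1..h}) \<rightarrow>\<^sub>E A. B_equation k h (\<lambda>l i. x (l, i))}"

lemma solutions_finite: "finite A \<Longrightarrow> finite (solutions k h A)"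
  unfolding solutions_def by (rule finite_subset[of _ "({1..k} \<times> {1..h}) \<rightarrow>\<^sub>E A"]) (auto intro: finite_PiE)

text \<open>At most \<open>card J div h\<close> rows lie entirely in \<open>J\<close>. One row fixes
  the common sum, and every other row that is not full has a position outside \<open>J\<close> whose
  value follows by cancellation. Only the remaining positions are free.\<close>

lemma solutions_extending_bound:
  fixes A :: "'a::cancel_comm_monoid_add set"
  assumes A: "finite A" "A \<noteq> {}" and k: "k \<ge> 1" and h: "h \<ge> 1" and J: "J \<subseteq> {1..k} \<times> {1..h}"
  shows "card {x \<in> solutions k h A. \<forall>p\<in>J. x p = y p}
    \<le> card A ^ (k * h + max 1 (card J div h) - (card J + k))"
proof -
  let ?Pos = "{1..k} \<times> {1..h}"
  let ?S = "{x \<in> solutions k h A. \<forall>p\<in>J. x p = y p}"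
  define full where "full = {l\<in>{1..k}. {l} \<times> {1..h} \<subseteq> J}"
  have fJ: "finite J" using J finite_subset by blast
  have "card full * h = card (full \<times> {1..h})" by (simp add: card_cartesian_product)
  also have "\<dots> \<le> card J" using fJ by (intro card_mono) (auto simp: full_def)
  finally have full_le: "card full \<le> card J div h" using h by (simp add: less_eq_div_iff_mult_less_eq)
  have fin_full: "finite full" by (simp add: full_def)
  \<comment> \<open>Taking \<open>l0\<close> among the full rows whenever there is one makes the
    number of rows without a determined position exactly \<open>max 1 (card full)\<close>.\<close>
  obtain l0 where l0: "l0 \<in> {1..k}" "full \<noteq> {} \<Longrightarrow> l0 \<in> full"
  proof (cases "full = {}")
    case True
    thus ?thesis using that[of 1] k by auto
  next
    case False
    then obtain l where "l \<in> full" by auto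
    thus ?thesis using that[of l] by (auto simp: full_def)
  qed
  have "card (insert l0 full) = max 1 (card full)"
    using l0 fin_full by (cases "full = {}") (auto simp: insert_absorb card_gt_0_iff max_def Suc_le_eq)
  hence card_l0: "card (insert l0 full) \<le> max 1 (card J div h)" using full_le by auto
  have "\<forall>l\<in>{1..k} - full. \<exists>i\<in>{1..h}. (l, i) \<notin> J" by (auto simp: full_def)
  then obtain f where f: "\<And>l. l \<in> {1..k} - full \<Longrightarrow> f l \<in> {1..h} \<and> (l, f l) \<notin> J" by metis
  text \<open>The positions in \<open>R\<close> are determined by the row sum, which is read off row \<open>l0\<close>.\<close>
  define R where "R = (\<lambda>l. (l, f l)) ` ({1..k} - insert l0 full)"
  have cR: "card R = k - card (insert l0 full)"
  proof -
    have "card R = card ({1..k} - insert l0 full)"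
      unfolding R_def by (rule card_image) (auto simp: inj_on_def)
    also have "\<dots> = k - card (insert l0 full)"
      using l0 by (subst card_Diff_subset) (auto simp: full_def)
    finally show ?thesis .
  qed
  have l0k: "card (insert l0 full) \<le> k"
  proof -
    have "insert l0 full \<subseteq> {1..k}" using l0(1) by (auto simp: full_def)
    from card_mono[OF _ this] show ?thesis by simp
  qed
  have RJ: "R \<inter> J = {}" "R \<subseteq> ?Pos" using f by (auto simp: R_def)
  define F where "F = ?Pos - (J \<union> R)"
  have "card F = card ?Pos - card (J \<union> R)"
    unfolding F_def using J RJ fJ finite_subset[OF RJ(2)] by (intro card_Diff_subset) auto
  also have "card (J \<union> R) = card J + card R"
    using fJ RJ finite_subset[OF RJ(2)] by (intro card_Un_disjoint) auto
  finally have "card F = k * h - (card J + card R)" by simp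
  hence cF: "card F \<le> k * h + max 1 (card J div h) - (card J + k)"
    using cR l0k card_l0 by linarith
  have "inj_on (\<lambda>x. restrict x F) ?S"
  proof (rule inj_onI)
    fix x z assume x: "x \<in> ?S" and z: "z \<in> ?S" and eq: "restrict x F = restrict z F"
    have agree: "x p = z p" if "p \<in> ?Pos" "p \<notin> R" for p
    proof (cases "p \<in> J")
      case False
      hence "p \<in> F" using that by (auto simp: F_def)
      thus ?thesis using fun_cong[OF eq, of p] by simp
    qed (use x z in auto)
    have row0: "(\<Sum>i=1..h. x (l0, i)) = (\<Sum>i=1..h. z (l0, i))"
      using l0(1) by (intro sum.cong refl agree) (auto simp: R_def)
    have rows: "(\<Sum>i=1..h. x (l, i)) = (\<Sum>i=1..h. z (l, i))" if "l \<in> {1..k}" for l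
    proof -
      have "(\<Sum>i=1..h. x (l, i)) = (\<Sum>i=1..h. x (l0, i))" "(\<Sum>i=1..h. z (l, i)) = (\<Sum>i=1..h. z (l0, i))"
        using x z that l0(1) unfolding solutions_def B_equation_def by blast+
      thus ?thesis using row0 by simp
    qed
    have "x p = z p" if p: "p \<in> ?Pos" for p
    proof (cases "p \<in> R")
      case True
      then obtain l where l: "l \<in> {1..k} - insert l0 full" "p = (l, f l)" unfolding R_def by blast
      have fl: "f l \<in> {1..h}" using p l by auto
      have "(\<Sum>i\<in>{1..h} - {f l}. x (l, i)) = (\<Sum>i\<in>{1..h} - {f l}. z (l, i))"
        using l by (intro sum.cong refl agree) (auto simp: R_def)
      moreover have "x (l, f l) + (\<Sum>i\<in>{1..h} - {f l}. x (l, i)) = z (l, f l) + (\<Sum>i\<in>{1..h} - {f l}. z (l, i))"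
        using rows[of l] l fl sum.remove[of "{1..h}" "f l" "\<lambda>i. x (l, i)"]
          sum.remove[of "{1..h}" "f l" "\<lambda>i. z (l, i)"] by simp
      ultimately show ?thesis using l by simp
    qed (use agree p in auto)
    thus "x = z" using x z by (intro PiE_ext[of x ?Pos "\<lambda>_. A" z]) (auto simp: solutions_def)
  qed
  moreover have "(\<lambda>x. restrict x F) ` ?S \<subseteq> F \<rightarrow>\<^sub>E A"
  proof (rule image_subsetI)
    fix x assume "x \<in> ?S"
    hence x: "x \<in> ?Pos \<rightarrow>\<^sub>E A" by (simp add: solutions_def)
    have "x p \<in> A" if "p \<in> F" for p using PiE_mem[OF x] that by (simp add: F_def)
    thus "restrict x F \<in> F \<rightarrow>\<^sub>E A" by simp
  qed
  moreover have "finite F" by (simp add: F_def)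
  ultimately have "card ?S \<le> card (F \<rightarrow>\<^sub>E A)"
    using A by (intro card_inj_on_le[of "\<lambda>x. restrict x F"]) (auto intro: finite_PiE)
  also have "\<dots> = card A ^ card F" using \<open>finite F\<close> by (simp add: card_PiE)
  also have "\<dots> \<le> card A ^ (k * h + max 1 (card J div h) - (card J + k))"
    using A cF by (intro power_increasing) (auto simp: Suc_le_eq card_gt_0_iff)
  finally show ?thesis .
qed

section \<open>Templates as vertex sets\<close>

definition rainbow_edges :: "nat \<Rightarrow> nat \<Rightarrow> nat \<Rightarrow> 'a::comm_monoid_add set \<Rightarrow> ('a \<times> nat) set set" where
  "rainbow_edges k h r A = Sigma A ` {Q. rainbow_solution k h r A Q}"

lemma templates_Sigma_subset: "P \<in> templates r A \<Longrightarrow> Sigma A P \<subseteq> A \<times> {1..r}"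
  by (auto simp: templates_def PiE_def Pi_def)

lemma inj_on_Sigma_templates: "inj_on (Sigma A) (templates r A)"
proof (rule inj_onI)
  fix P Q assume P: "P \<in> templates r A" and Q: "Q \<in> templates r A" and eq: "Sigma A P = Sigma A Q"
  have "P x = Q x" if "x \<in> A" for x
  proof -
    have "c \<in> P x \<longleftrightarrow> c \<in> Q x" for c
      using that eq by (metis (no_types, lifting) mem_Sigma_iff)
    thus ?thesis by blast
  qed
  thus "P = Q" using P Q by (intro PiE_ext[of P A "\<lambda>_. Pow {1..r}" Q]) (auto simp: templates_def)
qed

lemma subtemplate_iff_Sigma: "subtemplate A P Q \<longleftrightarrow> Sigma A P \<subseteq> Sigma A Q"
  by (auto simp: subtemplate_def)

lemma Sigma_rainbow_subtemplates:
  "Sigma A ` rainbow_subtemplates k h r A P = {e \<in> rainbow_edges k h r A. e \<subseteq> Sigma A P}"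
  by (auto simp: rainbow_subtemplates_def rainbow_edges_def subtemplate_iff_Sigma)

lemma rainbow_count_eq:
  "rainbow_count k h r A P = card {e \<in> rainbow_edges k h r A. e \<subseteq> Sigma A P}"
proof -
  have "rainbow_subtemplates k h r A P \<subseteq> templates r A"
    by (auto simp: rainbow_subtemplates_def rainbow_solution_def)
  hence "inj_on (Sigma A) (rainbow_subtemplates k h r A P)"
    using inj_on_Sigma_templates inj_on_subset by blast
  thus ?thesis by (simp add: rainbow_count_def card_image flip: Sigma_rainbow_subtemplates)
qed

lemma rainbow_free_iff:
  "rainbow_free k h r A P \<longleftrightarrow> (\<forall>e\<in>rainbow_edges k h r A. \<not> e \<subseteq> Sigma A P)"
proof -
  have "rainbow_free k h r A P \<longleftrightarrow> Sigma A ` rainbow_subtemplates k h r A P = {}"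
    by (simp add: rainbow_free_def)
  thus ?thesis unfolding Sigma_rainbow_subtemplates by blast
qed

lemma rainbow_edges_subset: "rainbow_edges k h r A \<subseteq> Pow (A \<times> {1..r})"
proof
  fix e assume "e \<in> rainbow_edges k h r A"
  then obtain Q where "e = Sigma A Q" "Q \<in> templates r A"
    unfolding rainbow_edges_def rainbow_solution_def by blast
  thus "e \<in> Pow (A \<times> {1..r})" using templates_Sigma_subset[of Q r A] by simp
qed

text \<open>Palettes at solution points are singletons, so they amount to a colour for each
  position; pairwise distinct palettes make this colouring injective.\<close>

lemma rainbow_edgeE:
  assumes "e \<in> rainbow_edges k h r A"
  obtains x c where "x \<in> solutions k h A" and "c \<in> ({1..k} \<times> {1..h}) \<rightarrow>\<^sub>E {1..r}"
    and "inj_on c ({1..k} \<times> {1..h})" and "e = (\<lambda>p. (x p, c p)) ` ({1..k} \<times> {1..h})"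
proof -
  let ?Pos = "{1..k} \<times> {1..h}"
  obtain Q x where e: "e = Sigma A Q" and Q: "Q \<in> templates r A"
    and xA: "\<forall>l\<in>{1..k}. \<forall>i\<in>{1..h}. x l i \<in> A" and eq: "B_equation k h x"
    and c1: "\<forall>l\<in>{1..k}. \<forall>i\<in>{1..h}. card (Q (x l i)) = 1"
    and emp: "\<forall>y\<in>A. (\<forall>l\<in>{1..k}. \<forall>i\<in>{1..h}. y \<noteq> x l i) \<longrightarrow> Q y = {}"
    and inj: "inj_on (\<lambda>(l, i). Q (x l i)) ?Pos"
    using assms unfolding rainbow_edges_def rainbow_solution_def by auto
  define x' where "x' = restrict (\<lambda>(l, i). x l i) ?Pos"
  define c where "c = restrict (\<lambda>(l, i). the_elem (Q (x l i))) ?Pos"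
  have x': "x' (l, i) = x l i" and Qc: "Q (x l i) = {c (l, i)}" if "l \<in> {1..k}" "i \<in> {1..h}" for l i
  proof -
    show "x' (l, i) = x l i" using that by (simp add: x'_def)
    have "card (Q (x l i)) = 1" using c1 that by blast
    then obtain q where "Q (x l i) = {q}" by (auto simp: card_1_singleton_iff)
    thus "Q (x l i) = {c (l, i)}" using that by (simp add: c_def)
  qed
  have "B_equation k h (\<lambda>l i. x' (l, i))"
  proof -
    have "(\<Sum>i=1..h. x' (l, i)) = (\<Sum>i=1..h. x l i)" if "l \<in> {1..k}" for l
      using that x' by (intro sum.cong) auto
    thus ?thesis using eq unfolding B_equation_def by metis
  qed
  hence "x' \<in> solutions k h A" using xA by (auto simp: solutions_def x'_def)
  moreover have "c \<in> ?Pos \<rightarrow>\<^sub>E {1..r}"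
  proof (rule PiE_I)
    fix p assume "p \<in> ?Pos"
    then obtain l i where p: "p = (l, i)" "l \<in> {1..k}" "i \<in> {1..h}" by auto
    have "Q (x l i) \<subseteq> {1..r}" using Q xA p by (auto simp: templates_def PiE_def Pi_def)
    thus "c p \<in> {1..r}" using Qc p by auto
  qed (auto simp: c_def)
  moreover have "inj_on c ?Pos"
  proof (rule inj_onI)
    fix p q assume pq: "p \<in> ?Pos" "q \<in> ?Pos" "c p = c q"
    obtain l i l' i' where lq: "p = (l, i)" "q = (l', i')" by fastforce
    have "Q (x l i) = Q (x l' i')" using pq lq Qc by auto
    thus "p = q" using inj_onD[OF inj, of p q] pq lq by auto
  qed
  moreover have "e = (\<lambda>p. (x' p, c p)) ` ?Pos"
  proof (intro equalityI subsetI)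
    fix z assume "z \<in> e"
    then obtain y q where z: "z = (y, q)" "y \<in> A" "q \<in> Q y" by (auto simp: e)
    then obtain l i where li: "l \<in> {1..k}" "i \<in> {1..h}" "y = x l i" using emp by blast
    hence "z = (\<lambda>p. (x' p, c p)) (l, i)" using z Qc x' by auto
    thus "z \<in> (\<lambda>p. (x' p, c p)) ` ?Pos" using li by blast
  next
    fix z assume "z \<in> (\<lambda>p. (x' p, c p)) ` ?Pos"
    then obtain l i where li: "l \<in> {1..k}" "i \<in> {1..h}" "z = (x' (l, i), c (l, i))" by auto
    thus "z \<in> e" using Qc x' xA by (auto simp: e)
  qed
  ultimately show ?thesis using that by blast
qed

text \<open>Distinct colours already make the \<open>k * h\<close> coloured points distinct.\<close>

lemma card_rainbow_edge: "e \<in> rainbow_edges k h r A \<Longrightarrow> card e = k * h"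
proof -
  assume "e \<in> rainbow_edges k h r A"
  then obtain x :: "nat \<times> nat \<Rightarrow> 'a" and c where c: "inj_on c ({1..k} \<times> {1..h})"
    and e: "e = (\<lambda>p. (x p, c p)) ` ({1..k} \<times> {1..h})"
    by (rule rainbow_edgeE)
  have "inj_on (\<lambda>p. (x p, c p)) ({1..k} \<times> {1..h})"
    by (rule inj_onI) (use inj_onD[OF c] in blast)
  thus ?thesis by (simp add: e card_image card_cartesian_product)
qed

lemma rainbow_codegree_bound:
  fixes A :: "'a::cancel_comm_monoid_add set"
  assumes A: "finite A" "A \<noteq> {}" and k: "k \<ge> 1" and h: "h \<ge> 1" and T: "finite T"
  shows "card {e \<in> rainbow_edges k h r A. T \<subseteq> e}
    \<le> (k * h) ^ card T * r ^ (k * h) * card A ^ (k * h + max 1 (card T div h) - (card T + k))"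
proof -
  let ?Pos = "{1..k} \<times> {1..h}" and ?D = "card A ^ (k * h + max 1 (card T div h) - (card T + k))"
  let ?\<Phi> = "{\<phi> \<in> T \<rightarrow>\<^sub>E ?Pos. inj_on \<phi> T}" and ?\<Gamma> = "?Pos \<rightarrow>\<^sub>E {1..r}"
  let ?X = "\<lambda>\<phi>. {x \<in> solutions k h A. \<forall>t\<in>T. x (\<phi> t) = fst t}"
  let ?g = "\<lambda>c x. (\<lambda>p. (x p, c p)) ` ?Pos"
  have fin\<Phi>: "finite (T \<rightarrow>\<^sub>E ?Pos)" and fin\<Gamma>: "finite ?\<Gamma>" using T by (auto intro: finite_PiE)
  have finX: "finite (?X \<phi>)" for \<phi> using solutions_finite[OF A(1)] by simp
  have "{e \<in> rainbow_edges k h r A. T \<subseteq> e} \<subseteq> (\<Union>\<phi>\<in>?\<Phi>. \<Union>c\<in>?\<Gamma>. ?g c ` ?X \<phi>)"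
  proof
    fix e assume "e \<in> {e \<in> rainbow_edges k h r A. T \<subseteq> e}"
    hence e: "e \<in> rainbow_edges k h r A" and Te: "T \<subseteq> e" by auto
    obtain x c where xc: "x \<in> solutions k h A" "c \<in> ?\<Gamma>" "e = ?g c x"
      using e by (rule rainbow_edgeE) 
    have "\<forall>t\<in>T. \<exists>p\<in>?Pos. t = (x p, c p)" using Te xc(3) by blast
    then obtain \<psi> where \<psi>: "\<And>t. t \<in> T \<Longrightarrow> \<psi> t \<in> ?Pos \<and> t = (x (\<psi> t), c (\<psi> t))" by metis
    define \<phi> where "\<phi> = restrict \<psi> T"
    have \<phi>1: "\<phi> t \<in> ?Pos" and \<phi>2: "(x (\<phi> t), c (\<phi> t)) = t" if "t \<in> T" for t
      using \<psi>[OF that] that unfolding \<phi>_def by (metis restrict_apply')+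
    have "inj_on \<phi> T"
      by (rule inj_onI) (metis \<phi>2)
    moreover have "\<phi> \<in> T \<rightarrow>\<^sub>E ?Pos"
      by (rule PiE_I) (use \<phi>1 in \<open>auto simp: \<phi>_def\<close>)
    moreover have "x (\<phi> t) = fst t" if "t \<in> T" for t
      by (metis \<phi>2[OF that] fst_conv)
    ultimately have "\<phi> \<in> ?\<Phi>" "x \<in> ?X \<phi>" using xc by auto
    thus "e \<in> (\<Union>\<phi>\<in>?\<Phi>. \<Union>c\<in>?\<Gamma>. ?g c ` ?X \<phi>)" using xc(2,3) by blast
  qed
  hence "card {e \<in> rainbow_edges k h r A. T \<subseteq> e} \<le> card (\<Union>\<phi>\<in>?\<Phi>. \<Union>c\<in>?\<Gamma>. ?g c ` ?X \<phi>)"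
    using fin\<Phi> fin\<Gamma> finX by (intro card_mono) auto
  also have "\<dots> \<le> (\<Sum>\<phi>\<in>?\<Phi>. card (\<Union>c\<in>?\<Gamma>. ?g c ` ?X \<phi>))"
    using fin\<Phi> by (intro card_UN_le) simp
  also have "\<dots> \<le> (\<Sum>\<phi>\<in>?\<Phi>. \<Sum>c\<in>?\<Gamma>. ?D)"
  proof (intro sum_mono)
    fix \<phi> assume "\<phi> \<in> ?\<Phi>"
    hence \<phi>: "inj_on \<phi> T" "\<phi> ` T \<subseteq> ?Pos" using PiE_mem[of \<phi> T "\<lambda>_. ?Pos"] by blast+
    \<comment> \<open>Injectivity of \<open>\<phi>\<close> turns conditions indexed by
      \<open>T\<close> into prescribed values at positions.\<close>
    have "?X \<phi> = {x \<in> solutions k h A. \<forall>p\<in>\<phi> ` T. x p = fst (the_inv_into T \<phi> p)}"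
      using \<phi>(1) by (auto simp: the_inv_into_f_f)
    hence X: "card (?X \<phi>) \<le> ?D"
      using solutions_extending_bound[OF A k h \<phi>(2), of "\<lambda>p. fst (the_inv_into T \<phi> p)"]
        card_image[OF \<phi>(1)] by simp
    have "card (\<Union>c\<in>?\<Gamma>. ?g c ` ?X \<phi>) \<le> (\<Sum>c\<in>?\<Gamma>. card (?g c ` ?X \<phi>))"
      by (rule card_UN_le[OF fin\<Gamma>])
    also have "\<dots> \<le> (\<Sum>c\<in>?\<Gamma>. ?D)"
    proof (rule sum_mono)
      fix c
      show "card (?g c ` ?X \<phi>) \<le> ?D" using card_image_le[OF finX[of \<phi>], of "?g c"] X by linarith
    qed
    finally show "card (\<Union>c\<in>?\<Gamma>. ?g c ` ?X \<phi>) \<le> (\<Sum>c\<in>?\<Gamma>. ?D)" .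
  qed
  also have "\<dots> = card ?\<Phi> * (r ^ (k * h) * ?D)" by (simp add: card_PiE)
  also have "\<dots> \<le> card (T \<rightarrow>\<^sub>E ?Pos) * (r ^ (k * h) * ?D)"
    using fin\<Phi> by (intro mult_right_mono card_mono) auto
  also have "\<dots> = (k * h) ^ card T * r ^ (k * h) * ?D" using T by (simp add: card_PiE)
  finally show ?thesis .
qed

section \<open>Choice of parameters\<close>

text \<open>Here \<open>j\<close> is the number of prescribed vertices. With \<open>a\<close> near
  \<open>y ^ (k * h - 1)\<close> and \<open>\<rho>\<close> near \<open>y ^ -(k * (h - 1))\<close>,
  the fourth claim says that for \<open>j < k * h\<close> the product
  \<open>\<rho> ^ (j - 1) * a ^ (j - g)\<close> has a full factor \<open>y\<close> to spare, up to
  powers of \<open>L\<close>.\<close>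

lemma codegree_exponents:
  fixes k h j g :: nat
  assumes k: "k \<ge> 2" and h: "h \<ge> 2" and j: "2 \<le> j" "j \<le> k * h" and g: "g = max 1 (j div h)"
  shows "1 \<le> g" and "g \<le> j" and "j + k \<le> k * h + g"
    and "j < k * h \<Longrightarrow> k * (h - 1) * (j - 1) + 1 \<le> (k * h - 1) * (j - g)"
    and "j = k * h \<Longrightarrow> g = k"
proof -
  show g1: "1 \<le> g" using g by simp
  have "j div h \<le> j" by simp
  thus gj: "g \<le> j" using g j by auto
  show "g = k" if "j = k * h" using that g h k by auto
  have gk: "g \<le> k" using g k j div_le_mono[of j "k * h" h] h by auto
  have "j < (j div h + 1) * h" using h div_less_iff_less_mult[of h j "j div h + 1"] by simp
  also have "\<dots> \<le> (g + 1) * h" using g by (intro mult_right_mono) auto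
  finally have jlt: "j < (g + 1) * h" .
  show "j + k \<le> k * h + g"
  proof (cases "g = k")
    case False
    then obtain u where u: "k = g + 1 + u" using gk by (metis Suc_eq_plus1 le_neq_implies_less less_iff_Suc_add add_Suc)
    obtain v where v: "h = v + 1" using h by (metis add.commute le_Suc_ex nat_1_add_1 add.assoc)
    show ?thesis using jlt unfolding u v by (simp add: algebra_simps)
  qed (use j in simp)
  show "k * (h - 1) * (j - 1) + 1 \<le> (k * h - 1) * (j - g)" if jk: "j < k * h"
  proof -
    \<comment> \<open>An equivalent form of the claim:
      \<open>(kh - 1)(j - g) - k(h - 1)(j - 1)\<close> equals
      \<open>(j - 1)(k - 1) - (g - 1)(kh - 1)\<close>.\<close>
    have "(int g - 1) * (int k * int h - 1) + 1 \<le> (int j - 1) * (int k - 1)"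
    proof (cases "g = 1")
      case True
      have "1 * 1 \<le> (int j - 1) * (int k - 1)" using j k by (intro mult_mono) auto
      thus ?thesis using True by simp
    next
      case False
      hence "g = j div h" using g by auto
      hence "g * h \<le> j" by simp
      hence "int g * int h \<le> int j" by (metis of_nat_le_iff of_nat_mult)
      hence "(int g * int h - 1) * (int k - 1) \<le> (int j - 1) * (int k - 1)"
        using k by (intro mult_right_mono) auto
      \<comment> \<open>\<open>(gh - 1)(k - 1)\<close> exceeds \<open>(g - 1)(kh - 1)\<close> by
        exactly \<open>(k - g)(h - 1)\<close>, so strictness of \<open>g < k\<close> supplies the
        extra 1.\<close>
      moreover have "g < k" using \<open>g * h \<le> j\<close> jk by (metis le_less_trans mult_less_cancel2)
      hence "1 * 1 \<le> (int k - int g) * (int h - 1)" using h by (intro mult_mono) auto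
      ultimately show ?thesis by (simp add: algebra_simps)
    qed
    hence "int k * (int h - 1) * (int j - 1) + 1 \<le> (int k * int h - 1) * (int j - int g)"
      by (simp add: algebra_simps)
    moreover have "1 \<le> k * h" using k h by simp
    ultimately have "int (k * (h - 1) * (j - 1) + 1) \<le> int ((k * h - 1) * (j - g))"
      using gj h j by (simp add: of_nat_diff)
    thus ?thesis by (simp only: of_nat_le_iff)
  qed
qed

text \<open>Cancelling the common power of \<open>a\<close> leaves the inequality
  \<open>main\<close>. For \<open>j < k * h\<close> the spare factor \<open>y\<close> absorbs
  \<open>C * L ^ (5 * k * h)\<close>; for \<open>j = k * h\<close> the powers of \<open>y\<close>
  cancel and only powers of \<open>L\<close> are compared.\<close>

lemma codegree_threshold:
  fixes k h j :: nat and L y a C \<rho> :: real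
  assumes k: "k \<ge> 2" and h: "h \<ge> 2" and j: "2 \<le> j" "j \<le> k * h"
    and L: "L \<ge> 1" "C \<le> L\<^sup>2" and y: "y \<ge> 1" "C * L ^ (5 * k * h) \<le> y"
    and a: "y ^ (k * h - 1) / L \<le> a" and \<rho>: "\<rho> = L ^ 8 / y ^ (k * (h - 1))"
  shows "C * a ^ (k * h + max 1 (j div h) - (j + k)) \<le> \<rho> ^ (j - 1) * a ^ (k * (h - 1)) / L ^ (5 * k * h)"
proof -
  define g where "g = max 1 (j div h)"
  note ex = codegree_exponents[OF k h j g_def]
  have kh: "k * h = k * (h - 1) + k" using h by (cases h) auto
  have a0: "a > 0" using a L y by (smt (verit) divide_pos_pos zero_less_power)
  have exps: "k * (h - 1) = (k * h + g - (j + k)) + (j - g)" using ex kh by linarith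
  have pow_a: "y ^ ((k * h - 1) * (j - g)) / L ^ (j - g) \<le> a ^ (j - g)"
    using power_mono[OF a, of "j - g"] L y by (simp add: power_divide power_mult)
  have \<rho>_pow: "\<rho> ^ (j - 1) = L ^ (8 * (j - 1)) / y ^ (k * (h - 1) * (j - 1))"
    by (simp add: \<rho> power_divide power_mult)
  have Lpos: "L > 0" and ypos: "y > 0" using L y by auto
  have main: "C * L ^ (5 * k * h) \<le> \<rho> ^ (j - 1) * a ^ (j - g)"
  proof (cases "j < k * h")
    case True
    have "C * L ^ (5 * k * h) \<le> y" by (rule y(2))
    also have "\<dots> = y ^ (k * (h - 1) * (j - 1) + 1) / y ^ (k * (h - 1) * (j - 1))"
      using ypos by simp
    also have "\<dots> \<le> y ^ ((k * h - 1) * (j - g)) / y ^ (k * (h - 1) * (j - 1))"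
      using y ypos ex(4)[OF True] by (intro divide_right_mono power_increasing) auto
    also have "\<dots> \<le> (L ^ (8 * (j - 1)) / L ^ (j - g)) * (y ^ ((k * h - 1) * (j - g)) / y ^ (k * (h - 1) * (j - 1)))"
    proof -
      have "L ^ (j - g) \<le> L ^ (8 * (j - 1))" using L ex(1) by (intro power_increasing) auto
      hence "1 \<le> L ^ (8 * (j - 1)) / L ^ (j - g)" using Lpos by simp
      hence "1 * (y ^ ((k * h - 1) * (j - g)) / y ^ (k * (h - 1) * (j - 1)))
        \<le> (L ^ (8 * (j - 1)) / L ^ (j - g)) * (y ^ ((k * h - 1) * (j - g)) / y ^ (k * (h - 1) * (j - 1)))"
        using ypos by (intro mult_right_mono) auto
      thus ?thesis by (simp only: mult_1_left)
    qed
    also have "\<dots> = \<rho> ^ (j - 1) * (y ^ ((k * h - 1) * (j - g)) / L ^ (j - g))"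
      unfolding \<rho>_pow by (simp add: mult_ac)
    also have "\<dots> \<le> \<rho> ^ (j - 1) * a ^ (j - g)"
      using pow_a Lpos ypos by (intro mult_left_mono) (auto simp: \<rho>)
    finally show ?thesis .
  next
    case False
    hence js: "j = k * h" and gk: "g = k" using j ex by auto
    have "4 \<le> k * h" using mult_mono[OF k h] by simp
    \<comment> \<open>This amounts to \<open>10 \<le> 2 * k * h + k\<close>, with equality at
      \<open>k = h = 2\<close>. The 2 pays for \<open>C\<close>, the term \<open>j - g\<close> for
      the factor \<open>1 / L\<close> in the lower bound on \<open>a\<close>.\<close>
    hence exl: "2 + 5 * k * h + (j - g) \<le> 8 * (j - 1)" using js gk k by linarith
    have same: "(k * h - 1) * (j - g) = k * (h - 1) * (j - 1)" using kh js gk by simp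
    have "C * L ^ (5 * k * h) \<le> L\<^sup>2 * L ^ (5 * k * h)" using L by (intro mult_right_mono) auto
    also have "\<dots> = L ^ (2 + 5 * k * h + (j - g)) / L ^ (j - g)"
      using Lpos by (simp add: power_add power2_eq_square)
    also have "\<dots> \<le> L ^ (8 * (j - 1)) / L ^ (j - g)"
      using L exl Lpos by (intro divide_right_mono power_increasing) auto
    also have "\<dots> = \<rho> ^ (j - 1) * (y ^ ((k * h - 1) * (j - g)) / L ^ (j - g))"
      unfolding \<rho>_pow same using ypos by simp
    also have "\<dots> \<le> \<rho> ^ (j - 1) * a ^ (j - g)"
      using pow_a Lpos ypos by (intro mult_left_mono) (auto simp: \<rho>)
    finally show ?thesis .
  qed
  have "C * L ^ (5 * k * h) * a ^ (k * h + g - (j + k)) \<le> \<rho> ^ (j - 1) * a ^ (j - g) * a ^ (k * h + g - (j + k))"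
    using main a0 by (intro mult_right_mono) auto
  also have "\<dots> = \<rho> ^ (j - 1) * a ^ (k * (h - 1))"
    by (subst exps) (simp add: power_add mult_ac)
  finally show ?thesis using Lpos by (simp add: g_def field_simps)
qed

section \<open>From hypergraph containers to templates\<close>

lemma rainbow_template_containers:
  fixes A :: "'a::cancel_comm_monoid_add set"
  assumes k: "k \<ge> 2" and h: "h \<ge> 2" and A: "finite A" "A \<noteq> {}" and r: "r \<ge> 1"
    and \<rho>: "\<rho> > 0" and t: "8 * real (k * h) * \<rho> * real (r * card A) \<le> real t" and \<theta>: "\<theta> > 0"
    and codeg: "\<And>j. 2 \<le> j \<Longrightarrow> j \<le> k * h \<Longrightarrow>
      real ((k * h) ^ (k * h) * r ^ (k * h)) * real (card A) ^ (k * h + max 1 (j div h) - (j + k))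
        \<le> \<rho> ^ (j - 1) * \<theta> / real (r * card A)"
    and n: "(1 - 1 / real (16 * (k * h) * 2 ^ ((k * h + 1)\<^sup>2))) ^ n *
      (real (r ^ (k * h)) * real (card A) ^ (k * (h - 1) + 1)) \<le> \<theta>"
  shows "\<exists>C. C \<subseteq> templates r A \<and>
      (\<forall>P\<in>templates r A. rainbow_free k h r A P \<longrightarrow> (\<exists>Q\<in>C. subtemplate A P Q)) \<and>
      (\<forall>P\<in>C. real (rainbow_count k h r A P) \<le> \<theta>) \<and>
      card C \<le> (r * card A + 1) ^ (k * h * t * n)"
proof -
  define s where "s = k * h"
  define V where "V = A \<times> {1..r}"
  define E where "E = rainbow_edges k h r A"
  have s: "s \<ge> 1" using k h by (simp add: s_def)
  have V: "finite V" and cV: "card V = r * card A"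
    using A by (simp_all add: V_def card_cartesian_product)
  have EV: "E \<subseteq> Pow V" unfolding E_def V_def by (rule rainbow_edges_subset)
  have Es: "card e = s" if "e \<in> E" for e using that card_rainbow_edge by (auto simp: E_def s_def)
  have bound: "real (card {e\<in>E. T \<subseteq> e}) \<le> \<rho> ^ (card T - 1) * \<theta> / real (card V)"
    if T: "T \<subseteq> V" "card T \<ge> 2" for T
  proof (cases "card T \<le> s")
    case True
    have fT: "finite T" using T V finite_subset by blast
    define D where "D = card A ^ (k * h + max 1 (card T div h) - (card T + k))"
    have "card {e\<in>E. T \<subseteq> e} \<le> s ^ card T * r ^ s * D"
      using rainbow_codegree_bound[OF A _ _ fT, of k h r] k h by (simp add: E_def s_def D_def)
    also have "\<dots> \<le> s ^ s * r ^ s * D"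
      using True s by (intro mult_right_mono power_increasing) auto
    finally have "real (card {e\<in>E. T \<subseteq> e}) \<le> real (s ^ s * r ^ s) * real D"
      by (metis of_nat_le_iff of_nat_mult)
    also have "\<dots> \<le> \<rho> ^ (card T - 1) * \<theta> / real (card V)"
      using codeg[of "card T"] T True by (simp add: s_def D_def cV)
    finally show ?thesis .
  next
    case False
    have "\<not> T \<subseteq> e" if "e \<in> E" for e
      using False Es[OF that] card_mono[of e T] EV V that finite_subset[of e V] by auto
    hence none: "{e\<in>E. T \<subseteq> e} = {}" by auto
    show ?thesis unfolding none using \<rho> \<theta> by simp
  qed
  define \<delta> :: real where "\<delta> = 1 / real (16 * s * 2 ^ ((s + 1)\<^sup>2))"
  have \<delta>: "\<delta> \<le> 1" unfolding \<delta>_def by (rule step_fraction_le_1[OF s])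
  have "card E \<le> r ^ s * card A ^ (k * (h - 1) + 1)"
  proof -
    \<comment> \<open>The number of edges is the codegree of the empty set, where
      \<open>max 1 (0 div h)\<close> is 1.\<close>
    have "k * h + 1 - k = k * (h - 1) + 1" using h by (cases h) auto
    thus ?thesis using rainbow_codegree_bound[OF A, of k h "{}" r] k h by (simp add: E_def s_def)
  qed
  hence "real (card E) \<le> real (r ^ s) * real (card A) ^ (k * (h - 1) + 1)"
    by (metis of_nat_le_iff of_nat_mult of_nat_power)
  hence "(1 - \<delta>) ^ n * card E \<le> (1 - \<delta>) ^ n * (real (r ^ s) * real (card A) ^ (k * (h - 1) + 1))"
    using \<delta> by (intro mult_left_mono) auto
  also have "\<dots> \<le> \<theta>" using n by (simp add: \<delta>_def s_def)
  finally have n': "(1 - 1 / real (16 * s * 2 ^ ((s + 1)\<^sup>2))) ^ n * card E \<le> \<theta>" by (simp add: \<delta>_def)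
  have t': "8 * real s * \<rho> * real (card V) \<le> real t" using t by (simp add: s_def cV)
  have "\<exists>\<C>. container_family V E \<theta> \<C> \<and> card \<C> \<le> (card V + 1) ^ (s * t * n)"
    using containers[of V s \<rho> t \<theta> E n] V s \<rho> t' \<theta> EV Es bound n' by simp
  then obtain \<C> where \<C>: "container_family V E \<theta> \<C>" "card \<C> \<le> (card V + 1) ^ (s * t * n)" by blast
  \<comment> \<open>The inverse of \<open>Sigma A\<close> on subsets of \<open>V\<close>, made
    extensional on \<open>A\<close>.\<close>
  define tmpl where "tmpl = (\<lambda>D :: ('a \<times> nat) set. \<lambda>x\<in>A. D `` {x})"
  have tmpl: "tmpl D \<in> templates r A" "Sigma A (tmpl D) = D" if "D \<subseteq> V" for D
    using that by (auto simp: tmpl_def templates_def V_def)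
  have sub: "D \<subseteq> V" "real (card {e\<in>E. e \<subseteq> D}) \<le> \<theta>" if "D \<in> \<C>" for D
    using \<C>(1) that by (auto simp: container_family_def)
  have "tmpl ` \<C> \<subseteq> templates r A" using tmpl(1) sub(1) by blast
  moreover have "\<exists>Q\<in>tmpl ` \<C>. subtemplate A P Q" if P: "P \<in> templates r A" "rainbow_free k h r A P" for P
  proof -
    have "Sigma A P \<subseteq> V" using templates_Sigma_subset[OF P(1)] by (simp add: V_def)
    moreover have "\<forall>e\<in>E. \<not> e \<subseteq> Sigma A P" using P(2) by (simp add: rainbow_free_iff E_def)
    ultimately obtain D where D: "D \<in> \<C>" "Sigma A P \<subseteq> D"
      using \<C>(1) unfolding container_family_def by meson
    hence "subtemplate A P (tmpl D)" using tmpl(2) sub(1) by (simp add: subtemplate_iff_Sigma)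
    thus ?thesis using D by blast
  qed
  moreover have "real (rainbow_count k h r A P) \<le> \<theta>" if "P \<in> tmpl ` \<C>" for P
    using that sub tmpl(2) by (auto simp: rainbow_count_eq E_def)
  moreover have "card (tmpl ` \<C>) \<le> (r * card A + 1) ^ (k * h * t * n)"
  proof -
    have "finite \<C>" using \<C>(1) by (simp add: container_family_def)
    from card_image_le[OF this, of tmpl] \<C>(2) show ?thesis by (simp add: cV s_def)
  qed
  ultimately show ?thesis by (intro exI[of _ "tmpl ` \<C>"]) simp
qed

section \<open>Grid size, growth estimates and the count of containers\<close>

lemma finite_grid: "finite (grid n :: (int ^ 'd::finite) set)"
  and card_grid_le: "card (grid n :: (int ^ 'd::finite) set) \<le> n ^ CARD('d)"
proof -
  let ?F = "(UNIV :: 'd set) \<rightarrow>\<^sub>E {1..int n}"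
  have inj: "inj_on (\<lambda>x. ($) x) (grid n :: (int ^ 'd) set)"
    by (auto simp: inj_on_def vec_nth_inject)
  have sub: "(\<lambda>x. ($) x) ` (grid n :: (int ^ 'd) set) \<subseteq> ?F" by (auto simp: grid_def PiE_def)
  have fin: "finite ?F" by (auto intro: finite_PiE)
  show "finite (grid n :: (int ^ 'd) set)" using inj sub fin by (metis finite_imageD finite_subset)
  have "card (grid n :: (int ^ 'd) set) \<le> card ?F" by (rule card_inj_on_le[OF inj sub fin])
  thus "card (grid n :: (int ^ 'd) set) \<le> n ^ CARD('d)" by (simp add: card_PiE)
qed

lemma eventually_log2_ge: "\<forall>\<^sub>F n in sequentially. log 2 (real n) \<ge> c"
proof -
  have "filterlim (\<lambda>n::nat. log 2 (real n)) at_top sequentially" by real_asymp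
  thus ?thesis by (simp add: filterlim_at_top)
qed

lemma eventually_log2_power_le_powr:
  fixes C q :: real
  assumes "q > 0"
  shows "\<forall>\<^sub>F n in sequentially. C * log 2 (real n) ^ m \<le> real n powr q"
proof -
  have "(\<lambda>n::nat. C * log 2 (real n) ^ m) \<in> o(\<lambda>n. real n powr q)" using assms by real_asymp
  hence "\<forall>\<^sub>F n in sequentially. norm (C * log 2 (real n) ^ m) \<le> 1 * norm (real n powr q)"
    by (rule landau_o.smallD) simp
  thus ?thesis by eventually_elim auto
qed

lemma eventually_exp_sqrt_log2_le:
  fixes C \<delta> :: real
  assumes "\<delta> > 0"
  shows "\<forall>\<^sub>F n in sequentially. C * log 2 (real n) ^ m * exp (- \<delta> * sqrt (log 2 (real n))) \<le> 1"
proof -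
  have "((\<lambda>n::nat. C * log 2 (real n) ^ m * exp (- \<delta> * sqrt (log 2 (real n)))) \<longlongrightarrow> 0) sequentially"
    using assms by real_asymp
  hence "\<forall>\<^sub>F n in sequentially. C * log 2 (real n) ^ m * exp (- \<delta> * sqrt (log 2 (real n))) < 1"
    by (rule order_tendstoD) simp
  thus ?thesis by eventually_elim auto
qed

text \<open>Up to constants \<open>t\<close> is \<open>\<rho> * a\<close>, \<open>T\<close> is
  \<open>sqrt L\<close> and the logarithm of the base is \<open>L\<close>; the logarithm of the
  count is thus at most \<open>K * \<rho> * a * L * sqrt L\<close>, and
  \<open>K \<le> sqrt L\<close> gives \<open>L\<^sup>2\<close>. The hypotheses
  \<open>\<rho> * a \<ge> 1\<close> and \<open>L \<ge> 1\<close> absorb the rounding in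
  \<open>t\<close> and \<open>T\<close>.\<close>

lemma container_count_bound:
  fixes s r d t T :: nat and L a \<rho> K :: real
  assumes s: "s \<ge> 1" and r: "r \<ge> 1" and L: "L \<ge> 1" and a: "a \<ge> 1" "log 2 a \<le> d * L"
    and \<rho>: "\<rho> > 0" "\<rho> * a \<ge> 1"
    and t: "t = nat \<lceil>8 * real s * \<rho> * (real r * a)\<rceil>" and T: "T = nat \<lceil>sqrt L\<rceil>"
    and K: "K = 2 * real s * (8 * real s * real r + 1) * (log 2 (2 * real r) + d)" "K \<le> sqrt L"
  shows "(real r * a + 1) ^ (s * t * T) \<le> 2 powr (a * \<rho> * L\<^sup>2)"
proof -
  have ra: "real r * a \<ge> 1" using mult_mono[of 1 "real r" 1 a] r a by simp
  have "log 2 (real r * a + 1) \<le> log 2 (2 * real r * a)" using ra by (intro log_mono) (simp_all add: algebra_simps)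
  also have "\<dots> = log 2 (2 * real r) + log 2 a" using r a by (simp add: log_mult)
  also have "\<dots> \<le> log 2 (2 * real r) * L + d * L"
  proof -
    have "log 2 (2 * real r) \<ge> 0" using r by simp
    from mult_left_mono[OF L this] show ?thesis using a(2) by simp
  qed
  finally have lg: "log 2 (real r * a + 1) \<le> (log 2 (2 * real r) + d) * L" by (simp add: algebra_simps)
  have lg0: "log 2 (real r * a + 1) \<ge> 0" using ra by simp
  have sL: "1 \<le> sqrt L" using L by simp
  have "real T \<le> sqrt L + 1" unfolding T using sL by linarith
  hence T2: "real T \<le> 2 * sqrt L" using sL by linarith
  have "0 \<le> 8 * real s * \<rho> * (real r * a)" using \<rho> ra by simp
  hence "real t \<le> 8 * real s * \<rho> * (real r * a) + 1" unfolding t by linarith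
  hence t2: "real t \<le> (8 * real s * real r + 1) * (\<rho> * a)" using \<rho>(2) by (simp add: algebra_simps)
  have "real (s * t * T) * log 2 (real r * a + 1)
    \<le> (real s * ((8 * real s * real r + 1) * (\<rho> * a)) * (2 * sqrt L)) * ((log 2 (2 * real r) + d) * L)"
    unfolding of_nat_mult using t2 T2 lg lg0 \<rho>(2) sL by (intro mult_mono) (auto intro!: mult_nonneg_nonneg)
  also have "\<dots> = K * (\<rho> * a) * (sqrt L * L)" by (simp add: K(1) mult_ac)
  also have "\<dots> \<le> sqrt L * (\<rho> * a) * (sqrt L * L)"
    using K(2) \<rho>(2) sL L by (intro mult_right_mono) auto
  also have "\<dots> = (\<rho> * a) * ((sqrt L * sqrt L) * L)" by (simp only: mult_ac)
  also have "\<dots> = a * \<rho> * L\<^sup>2" using L by (simp add: power2_eq_square)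
  finally have ex: "real (s * t * T) * log 2 (real r * a + 1) \<le> a * \<rho> * L\<^sup>2" .
  have "(real r * a + 1) ^ (s * t * T) = 2 powr (log 2 (real r * a + 1) * real (s * t * T))"
    using ra by (simp add: powr_realpow power_mult flip: powr_powr)
  also have "\<dots> \<le> 2 powr (a * \<rho> * L\<^sup>2)" using ex by (simp add: mult.commute)
  finally show ?thesis .
qed

theorem theorem3p7:
  fixes k h r :: nat
  assumes "k \<ge> 2" and "h \<ge> 2" and "r \<ge> k * h"
  shows "\<forall>\<^sub>F n in sequentially. \<forall>A :: (int ^ 'd::finite) set.
    A \<subseteq> grid n \<and> real (card A) \<ge> real n ^ CARD('d) / log 2 (real n) \<longrightarrow>
    (\<exists>C. C \<subseteq> templates r A \<and>
      (\<forall>P\<in>templates r A. rainbow_free k h r A P \<longrightarrow> (\<exists>Q\<in>C. subtemplate A P Q)) \<and>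
      (\<forall>P\<in>C. real (rainbow_count k h r A P)
         \<le> 1 / log 2 (real n) ^ (5 * k * h) * real (card A) ^ (k * (h - 1) + 1)) \<and>
      real (card C) \<le> 2 powr (real (card A)
         * real n powr (- (real (k * (h - 1)) / real (k * h - 1)) * real CARD('d))
         * log 2 (real n) ^ 10))"
proof -
  let ?d = "CARD('d)"
  have s4: "k * h \<ge> 4" using mult_mono[OF assms(1,2)] by simp
  have r1: "r \<ge> 1" using s4 assms(3) by linarith
  have kh: "k * (h - 1) \<le> k * h - 1" using assms(1,2) by (cases h) auto
  define \<delta> :: real where "\<delta> = 1 / real (16 * (k * h) * 2 ^ ((k * h + 1)\<^sup>2))"
  have \<delta>0: "\<delta> > 0" using assms(1,2) by (simp add: \<delta>_def)
  \<comment> \<open>The extra factor \<open>r\<close> comes from the vertex set having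
    \<open>r * card A\<close> elements.\<close>
  define C0 where "C0 = real ((k * h) ^ (k * h) * r ^ (k * h)) * real r"
  define K where "K = 2 * real (k * h) * (8 * real (k * h) * real r + 1) * (log 2 (2 * real r) + ?d)"
  have q: "1 / real (k * h - 1) > 0" using s4 by simp
  show ?thesis
    \<comment> \<open>In order: \<open>L\<close> dominates the constants \<open>C0\<close> and
      \<open>K\<^sup>2\<close>; the spare factor \<open>y\<close> dominates
      \<open>C0 * L ^ (5 * k * h)\<close>; \<open>sqrt L\<close> rounds of the step bring the edges
      below \<open>\<theta>\<close>.\<close>
    using eventually_log2_ge[of "max 1 (max C0 (K\<^sup>2))"]
      eventually_log2_power_le_powr[OF q, of C0 "5 * k * h"]
      eventually_exp_sqrt_log2_le[OF \<delta>0, of "real (r ^ (k * h))" "5 * k * h"]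
  proof eventually_elim
    case (elim n)
    define L where "L = log 2 (real n)"
    have L: "L \<ge> 1" "L \<ge> C0" "L \<ge> K\<^sup>2" using elim(1) by (auto simp: L_def)
    have L0: "L > 0" using L by simp
    have n1: "real n \<ge> 1"
    proof (rule ccontr)
      assume "\<not> real n \<ge> 1"
      hence "n = 0" by simp
      \<comment> \<open>At \<open>n = 0\<close> the logarithm has the default value 0.\<close>
      thus False using L(1) by (simp add: L_def log_def)
    qed
    have "K \<le> sqrt L" using L(3) by (simp add: real_le_rsqrt)
    have "L * 1 \<le> L * L" using L by (intro mult_left_mono) auto
    hence L2: "C0 \<le> L\<^sup>2" using L(2) by (simp add: power2_eq_square)
    define y where "y = real n powr (real ?d / real (k * h - 1))"
    have y1: "y \<ge> 1" using n1 by (simp add: y_def ge_one_powr_ge_zero)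
    have y_pow: "y ^ m = real n powr (real m / real (k * h - 1) * real ?d)" for m
      using n1 by (simp add: y_def powr_powr mult.commute flip: powr_realpow)
    have y_s: "y ^ (k * h - 1) = real n ^ ?d"
      unfolding y_pow using n1 s4 by (simp add: powr_realpow)
    have "real n powr (1 / real (k * h - 1)) \<le> y"
      unfolding y_def using n1 by (intro powr_mono divide_right_mono) (auto simp: Suc_le_eq)
    hence yC: "C0 * L ^ (5 * k * h) \<le> y" using elim(2) by (simp add: L_def)
    define \<rho> where "\<rho> = L ^ 8 / y ^ (k * (h - 1))"
    have \<rho>0: "\<rho> > 0" using L0 y1 by (simp add: \<rho>_def)
    show ?case
    proof (intro allI impI)
      fix A :: "(int ^ 'd) set"
      assume "A \<subseteq> grid n \<and> real (card A) \<ge> real n ^ ?d / log 2 (real n)"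
      hence Ag: "A \<subseteq> grid n" and Ac: "real n ^ ?d / L \<le> real (card A)" by (auto simp: L_def)
      define a where "a = real (card A)"
      have finA: "finite A" using Ag finite_grid finite_subset by blast
      have "a > 0" using Ac n1 L0 unfolding a_def
        by (smt (verit) divide_pos_pos zero_less_power)
      hence A_ne: "A \<noteq> {}" by (auto simp: a_def)
      have a1: "a \<ge> 1" using \<open>a > 0\<close> by (simp add: a_def Suc_le_eq)
      have "card A \<le> n ^ ?d" using card_mono[OF finite_grid Ag] card_grid_le[where 'd='d] by (rule le_trans)
      hence "a \<le> real n ^ ?d" unfolding a_def by (metis of_nat_le_iff of_nat_power)
      hence "log 2 a \<le> log 2 (real n ^ ?d)" using a1 n1 by simp
      hence loga: "log 2 a \<le> ?d * L" using n1 by (simp add: L_def log_nat_power)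
      have ya: "y ^ (k * h - 1) / L \<le> a" using Ac y_s by (simp add: a_def)
      have "1 * 1 \<le> L ^ 7 * (y ^ (k * h - 1) / y ^ (k * (h - 1)))"
        using L y1 kh by (intro mult_mono one_le_power) (auto intro!: power_increasing)
      also have "\<dots> = \<rho> * (y ^ (k * h - 1) / L)"
        using L0 y1 by (simp add: \<rho>_def field_simps flip: power_Suc)
      also have "\<dots> \<le> \<rho> * a" using ya \<rho>0 by (intro mult_left_mono) auto
      finally have \<rho>a: "\<rho> * a \<ge> 1" by simp
      define \<theta> where "\<theta> = 1 / L ^ (5 * k * h) * a ^ (k * (h - 1) + 1)"
      have \<theta>0: "\<theta> > 0" using L0 \<open>a > 0\<close> by (simp add: \<theta>_def)
      define t where "t = nat \<lceil>8 * real (k * h) * \<rho> * (real r * a)\<rceil>"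
      \<comment> \<open>The number of rounds: large enough for
        \<open>exp (- \<delta> * sqrt L)\<close> to beat every power of \<open>L\<close>, small
        enough to keep the count of containers within the allowed power of \<open>L\<close>.\<close>
      define T where "T = nat \<lceil>sqrt L\<rceil>"
      have tt: "8 * real (k * h) * \<rho> * real (r * card A) \<le> real t"
      proof -
        have ra: "real (r * card A) = real r * a" by (simp add: a_def)
        show ?thesis unfolding t_def ra by (rule real_nat_ceiling_ge)
      qed
      have cod: "real ((k * h) ^ (k * h) * r ^ (k * h)) * real (card A) ^ (k * h + max 1 (j div h) - (j + k))
        \<le> \<rho> ^ (j - 1) * \<theta> / real (r * card A)" if j: "2 \<le> j" "j \<le> k * h" for j
      proof -
        have "C0 * a ^ (k * h + max 1 (j div h) - (j + k))
          \<le> \<rho> ^ (j - 1) * a ^ (k * (h - 1)) / L ^ (5 * k * h)"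
          by (rule codegree_threshold[OF assms(1,2) j L(1) L2 y1 yC ya \<rho>_def])
        also have "\<dots> = real r * (\<rho> ^ (j - 1) * \<theta> / real (r * card A))"
          using \<open>a > 0\<close> r1 by (simp add: \<theta>_def a_def)
        finally have "real r * (real ((k * h) ^ (k * h) * r ^ (k * h)) * real (card A) ^ (k * h + max 1 (j div h) - (j + k)))
          \<le> real r * (\<rho> ^ (j - 1) * \<theta> / real (r * card A))"
          by (simp only: C0_def a_def mult_ac)
        thus ?thesis using r1 by (subst (asm) mult_le_cancel_left_pos) auto
      qed
      have iter: "(1 - \<delta>) ^ T * (real (r ^ (k * h)) * real (card A) ^ (k * (h - 1) + 1)) \<le> \<theta>"
      proof -
        have "\<delta> \<le> 1" unfolding \<delta>_def using s4 by (intro step_fraction_le_1) linarith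
        moreover have "1 - \<delta> \<le> exp (- \<delta>)" using exp_ge_add_one_self[of "- \<delta>"] by simp
        ultimately have "(1 - \<delta>) ^ T \<le> exp (- \<delta>) ^ T" by (intro power_mono) auto
        also have "\<dots> = exp (- \<delta> * real T)" by (simp add: exp_of_nat_mult mult.commute flip: exp_of_nat2_mult)
        also have "\<dots> \<le> exp (- \<delta> * sqrt L)"
        proof -
          have "sqrt L \<le> real T" unfolding T_def by linarith
          thus ?thesis using \<delta>0 by simp
        qed
        finally have "(1 - \<delta>) ^ T \<le> exp (- \<delta> * sqrt L)" .
        hence "real (r ^ (k * h)) * L ^ (5 * k * h) * (1 - \<delta>) ^ T
          \<le> real (r ^ (k * h)) * L ^ (5 * k * h) * exp (- \<delta> * sqrt L)"
          using L0 by (intro mult_left_mono) auto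
        also have "\<dots> \<le> 1" using elim(3) by (simp add: L_def)
        finally have "(1 - \<delta>) ^ T * real (r ^ (k * h)) \<le> 1 / L ^ (5 * k * h)"
          using L0 by (simp add: field_simps)
        hence "(1 - \<delta>) ^ T * real (r ^ (k * h)) * a ^ (k * (h - 1) + 1) \<le> \<theta>"
          unfolding \<theta>_def using a1 by (intro mult_right_mono) auto
        thus ?thesis by (simp add: a_def mult_ac)
      qed
      obtain C where C: "C \<subseteq> templates r A"
        "\<forall>P\<in>templates r A. rainbow_free k h r A P \<longrightarrow> (\<exists>Q\<in>C. subtemplate A P Q)"
        "\<forall>P\<in>C. real (rainbow_count k h r A P) \<le> \<theta>"
        "card C \<le> (r * card A + 1) ^ (k * h * t * T)"
        using rainbow_template_containers[OF assms(1,2) finA A_ne r1 \<rho>0 tt \<theta>0 cod iter[unfolded \<delta>_def]]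
        by blast
      have "real (card C) \<le> real ((r * card A + 1) ^ (k * h * t * T))" using C(4) by (rule of_nat_mono)
      also have "\<dots> = (real r * a + 1) ^ (k * h * t * T)" by (simp add: a_def add.commute)
      also have "\<dots> \<le> 2 powr (a * \<rho> * L\<^sup>2)"
        using s4 by (intro container_count_bound[OF _ r1 L(1) a1 loga \<rho>0 \<rho>a t_def T_def K_def \<open>K \<le> sqrt L\<close>]) linarith
      \<comment> \<open>The exponent 10 is 8 from \<open>\<rho>\<close> plus 2 from the count of
        containers.\<close>
      also have "a * \<rho> * L\<^sup>2 = a * real n powr (- (real (k * (h - 1)) / real (k * h - 1)) * real ?d) * L ^ 10"
      proof -
        have "L ^ 10 = L ^ 8 * L\<^sup>2" by (simp flip: power_add)
        moreover have "real n powr (- (real (k * (h - 1)) / real (k * h - 1)) * real ?d) = 1 / y ^ (k * (h - 1))"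
          unfolding y_pow by (simp add: powr_minus_divide)
        ultimately show ?thesis by (simp add: \<rho>_def)
      qed
      finally have "real (card C) \<le> 2 powr (real (card A)
         * real n powr (- (real (k * (h - 1)) / real (k * h - 1)) * real ?d) * log 2 (real n) ^ 10)"
        by (simp only: a_def L_def)
      thus "\<exists>C. C \<subseteq> templates r A \<and>
        (\<forall>P\<in>templates r A. rainbow_free k h r A P \<longrightarrow> (\<exists>Q\<in>C. subtemplate A P Q)) \<and>
        (\<forall>P\<in>C. real (rainbow_count k h r A P)
           \<le> 1 / log 2 (real n) ^ (5 * k * h) * real (card A) ^ (k * (h - 1) + 1)) \<and>
        real (card C) \<le> 2 powr (real (card A)
           * real n powr (- (real (k * (h - 1)) / real (k * h - 1)) * real ?d)
           * log 2 (real n) ^ 10)"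
        using C(1-3) unfolding \<theta>_def a_def L_def by blast
    qed
  qed
qed

end
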